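(* Let $B_n(t,\lambda,w)$ be the polynomials defined by the J-type continued fraction in the context. For every $n\ge0$, $$B_n(t,\lambda,w)=\sum_{\sigma\in\mathfrak S_n}t^{\mathrm{exc}\,\sigma}\lambda^{\mathrm{pcyc}\,\sigma}w^{\mathrm{fix}\,\sigma}=\sum_{\sigma\in\mathfrak S_n}t^{\mathrm{exc}\,\sigma}\lambda^{\mathrm{ear}\,\sigma}w^{\mathrm{fix}\,\sigma}=\sum_{\sigma\in\mathfrak S_n}t^{\mathrm{exc}\,\sigma}\lambda^{\mathrm{pex}\,\sigma}w^{\mathrm{fix}\,\sigma}=\sum_{\sigma\in\mathfrak S_n}t^{\mathrm{des}\,\sigma}\lambda^{\mathrm{des}_2\,\sigma}w^{\mathrm{fmax}\,\sigma},$$ and $$\sum_{n\ge0}B_n(t,\lambda,w)\frac{z^n}{n!}=e^{wz}\left(\frac{1-t}{e^{tz}-te^{z}}\right)^{\lambda}$$ as formal power series in $z$.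
   Context: $B_n(t,\lambda,w)$ ($n\ge 0$) is defined by $$\sum_{n\ge0}B_n(t,\lambda,w)z^n=\cfrac{1}{1-\gamma_0z-\cfrac{\beta_1z^2}{1-\gamma_1z-\cfrac{\beta_2z^2}{\cdots}}},\qquad \gamma_n=w+n(t+1)\ (n\ge 0),\quad \beta_n=nt(\lambda+n-1)\ (n\ge1).$$ The series $\frac{1-t}{e^{tz}-te^z}$ has constant term $1$ in $z$ and its $\lambda$-th power is $\exp(\lambda\log(\cdot))$. $\mathfrak S_n$ is the set of permutations of $[n]=\{1,\dots,n\}$ ($\mathfrak S_0$ consists of the empty permutation). For $\sigma\in\mathfrak S_n$: - $\mathrm{exc}\,\sigma$ is the number of $i$ with $\sigma(i)>i$; $\mathrm{pex}\,\sigma$ is the number of $i$ with $\sigma(i)>i$ and $\sigma(j)\notin[i,\sigma(i)]$ for all $j<i$. - $\mathrm{fix}\,\sigma$ is the number of fixed points, $\mathrm{cyc}\,\sigma$ the number of cycles (fixed points included), $\mathrm{pcyc}\,\sigma=\mathrm{cyc}\,\sigma-\mathrm{fix}\,\sigma$. - An index $i$ (or the value $\sigma(i)$) is a record if $\sigma(j)<\sigma(i)$ for all $j<i$; an antirecord if $\sigma(j)>\sigma(i)$ for all $j>i$; an exclusive antirecord if it is an antirecord and not a record; $i$ is a cycle peak if $\sigma^{-1}(i)<i>\sigma(i)$. $\mathrm{ear}\,\sigma$ is the number of $i$ that are both an exclusive antirecord and a cycle peak. - $\mathrm{des}\,\sigma$ is the number of descents, i.e. $i\in[1,n-1]$ with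 $\sigma(i)>\sigma(i+1)$; $\mathrm{des}_2\,\sigma$ is the number of descents of type 2, i.e. descents $i$ with $\sigma(j)<\sigma(i)$ for all $j<i$. - With the convention $\sigma(0)=0$, $\sigma(n+1)=n+1$, the value $\sigma(i)$ ($1\le i\le n$) is a double ascent if $\sigma(i-1)<\sigma(i)<\sigma(i+1)$; a foremaximum is a double ascent that is also a record; $\mathrm{fmax}\,\sigma$ is the number of foremaxima. *)

theory Defs
  imports
    "HOL-Computational_Algebra.Computational_Algebra"
    "HOL-Combinatorics.Combinatorics"
begin

section \<open>Jacobi-type continued fractions\<close>

text \<open>
  \<open>J_convergent \<gamma> \<beta> k m\<close> is the part of the fraction that starts at level \<open>k\<close>,
  with its first \<open>m\<close> levels kept and the remaining tail replaced by \<open>0\<close>: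
  \<open>1 / (1 - \<gamma> k z - \<beta> (k+1) z^2 / (1 - \<gamma> (k+1) z - ...))\<close>.
\<close>

fun J_convergent ::
  "(nat \<Rightarrow> 'a::field) \<Rightarrow> (nat \<Rightarrow> 'a) \<Rightarrow> nat \<Rightarrow> nat \<Rightarrow> 'a fps"
where
  "J_convergent \<gamma> \<beta> k 0 = 0"
| "J_convergent \<gamma> \<beta> k (Suc m) =
     1 / (1 - fps_const (\<gamma> k) * fps_X
            - fps_const (\<beta> (Suc k)) * fps_X ^ 2 * J_convergent \<gamma> \<beta> (Suc k) m)"

text \<open>
  The limit is taken in the metric on formal power series, where convergence means that
  each coefficient is eventually constant; it always exists
  (\<open>J_convergent_LIMSEQ\<close> below).
\<close>

definition J_fraction :: "(nat \<Rightarrow> 'a::field) \<Rightarrow> (nat \<Rightarrow> 'a) \<Rightarrow> 'a fps" where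
  "J_fraction \<gamma> \<beta> = lim (\<lambda>m. J_convergent \<gamma> \<beta> 0 m)"

lemma fps_mult_nth_eq_0:
  fixes f g :: "'a::comm_ring_1 fps"
  assumes "\<And>i. i \<le> n \<Longrightarrow> fps_nth f i = 0"
  shows "fps_nth (f * g) n = 0"
  using assms by (auto simp: fps_mult_nth intro!: sum.neutral)

lemma J_convergent_stable:
  fixes \<gamma> \<beta> :: "nat \<Rightarrow> 'a::field"
  assumes "n < 2 * m" "m \<le> m'"
  shows "fps_nth (J_convergent \<gamma> \<beta> k m') n = fps_nth (J_convergent \<gamma> \<beta> k m) n"
  using assms
proof (induction m arbitrary: k n m')
  case 0
  then show ?case by simp
next
  case (Suc m)
  then obtain l where m': "m' = Suc l" and l: "m \<le> l"
    by (cases m') auto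
  define F where "F = J_convergent \<gamma> \<beta> (Suc k) m"
  define G where "G = J_convergent \<gamma> \<beta> (Suc k) l"
  define P where "P = 1 - fps_const (\<gamma> k) * fps_X - fps_const (\<beta> (Suc k)) * fps_X ^ 2 * F"
  define Q where "Q = 1 - fps_const (\<gamma> k) * fps_X - fps_const (\<beta> (Suc k)) * fps_X ^ 2 * G"
  have P0: "fps_nth P 0 = 1" and Q0: "fps_nth Q 0 = 1"
    by (simp_all add: P_def Q_def fps_mult_nth)
  have PI: "P * inverse P = 1" and QI: "Q * inverse Q = 1"
    using P0 Q0 by (simp_all add: inverse_mult_eq_1')
  have eq: "inverse Q - inverse P =
      (fps_X ^ 2 * (G - F)) * (fps_const (\<beta> (Suc k)) * inverse P * inverse Q)"
  proof -
    have "inverse Q - inverse P = (P * inverse P) * inverse Q - (Q * inverse Q) * inverse P"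
      by (simp add: PI QI)
    also have "\<dots> = (P - Q) * (inverse P * inverse Q)"
      by (simp add: algebra_simps)
    also have "P - Q = fps_const (\<beta> (Suc k)) * (fps_X ^ 2 * (G - F))"
      by (simp add: P_def Q_def algebra_simps)
    finally show ?thesis by (simp add: algebra_simps)
  qed
  have "fps_nth (fps_X ^ 2 * (G - F)) i = 0" if "i \<le> n" for i
  proof (cases "i < 2")
    case False
    then have "i - 2 < 2 * m" using Suc.prems(1) that by simp
    then have "fps_nth G (i - 2) = fps_nth F (i - 2)"
      unfolding F_def G_def using Suc.IH l by blast
    then show ?thesis by (simp add: fps_X_power_mult_nth)
  qed (simp add: fps_X_power_mult_nth)
  then have "fps_nth (inverse Q - inverse P) n = 0"
    unfolding eq by (rule fps_mult_nth_eq_0)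
  then show ?case
    by (simp add: m' F_def[symmetric] G_def[symmetric] P_def[symmetric] Q_def[symmetric]
        fps_divide_unit P0 Q0)
qed

lemma J_convergent_LIMSEQ:
  "(\<lambda>m. J_convergent \<gamma> \<beta> 0 m) \<longlonglongrightarrow> J_fraction \<gamma> \<beta>"
proof -
  define L where "L = Abs_fps (\<lambda>n. fps_nth (J_convergent \<gamma> \<beta> 0 (Suc n)) n)"
  have "(\<lambda>m. J_convergent \<gamma> \<beta> 0 m) \<longlonglongrightarrow> L"
  proof (rule tendsto_fpsI)
    fix n
    show "eventually (\<lambda>m. fps_nth (J_convergent \<gamma> \<beta> 0 m) n = fps_nth L n) sequentially"
      using eventually_ge_at_top[of "Suc n"]
      by eventually_elim (simp only: L_def fps_nth_Abs_fps, rule J_convergent_stable, auto)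
  qed
  then show ?thesis
    by (simp add: J_fraction_def limI)
qed

definition B :: "nat \<Rightarrow> 'a::field_char_0 \<Rightarrow> 'a \<Rightarrow> 'a \<Rightarrow> 'a" where
  "B n t lam w =
     fps_nth (J_fraction (\<lambda>k. w + of_nat k * (t + 1))
                         (\<lambda>k. of_nat k * t * (lam + of_nat k - 1))) n"

text \<open>
  Fraction fields of polynomial rings over the rationals have characteristic \<open>0\<close>, so that
  the indeterminates themselves are admissible arguments of \<open>B\<close>.
\<close>

instance fract :: ("{idom, ring_char_0}") field_char_0
proof
  have "of_nat n = Fract (of_nat n) (1::'a)" for n
    by (rule of_nat_fract)
  then show "inj (of_nat :: nat \<Rightarrow> 'a fract)"
    by (auto simp: inj_def eq_fract)
qed

section \<open>Powers of power series with arbitrary exponents\<close>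

text \<open>
  \<open>fps_ln 1\<close> is the series of \<open>ln (1 + z)\<close>. The definitions are meant for series with
  constant term \<open>1\<close>.
\<close>

definition fps_log :: "'a::field_char_0 fps \<Rightarrow> 'a fps" where
  "fps_log f = fps_compose (fps_ln 1) (f - 1)"

definition fps_pow :: "'a::field_char_0 fps \<Rightarrow> 'a \<Rightarrow> 'a fps" where
  "fps_pow f a = fps_compose (fps_exp 1) (fps_const a * fps_log f)"

section \<open>Permutation statistics\<close>

text \<open>
  Permutations of \<open>{1..n}\<close> are functions \<open>\<sigma> :: nat \<Rightarrow> nat\<close> with \<open>\<sigma> permutes {1..n}\<close>, hence
  the identity outside \<open>{1..n}\<close>. In particular \<open>\<sigma> 0 = 0\<close> and \<open>\<sigma> (n + 1) = n + 1\<close>, which is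
  the boundary convention needed for double ascents.
\<close>

definition exc :: "nat \<Rightarrow> (nat \<Rightarrow> nat) \<Rightarrow> nat" where
  "exc n \<sigma> = card {i \<in> {1..n}. \<sigma> i > i}"

definition pex :: "nat \<Rightarrow> (nat \<Rightarrow> nat) \<Rightarrow> nat" where
  "pex n \<sigma> = card {i \<in> {1..n}. \<sigma> i > i \<and> (\<forall>j\<in>{1..<i}. \<sigma> j \<notin> {i..\<sigma> i})}"

definition fixpts :: "nat \<Rightarrow> (nat \<Rightarrow> nat) \<Rightarrow> nat" where
  "fixpts n \<sigma> = card {i \<in> {1..n}. \<sigma> i = i}"

definition cyc :: "nat \<Rightarrow> (nat \<Rightarrow> nat) \<Rightarrow> nat" where
  "cyc n \<sigma> = card (orbit \<sigma> ` {1..n})"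

text \<open>No truncation occurs, since each fixed point is a cycle of its own.\<close>

definition pcyc :: "nat \<Rightarrow> (nat \<Rightarrow> nat) \<Rightarrow> nat" where
  "pcyc n \<sigma> = cyc n \<sigma> - fixpts n \<sigma>"

definition is_record :: "nat \<Rightarrow> (nat \<Rightarrow> nat) \<Rightarrow> nat \<Rightarrow> bool" where
  "is_record n \<sigma> i \<longleftrightarrow> i \<in> {1..n} \<and> (\<forall>j\<in>{1..<i}. \<sigma> j < \<sigma> i)"

definition is_antirecord :: "nat \<Rightarrow> (nat \<Rightarrow> nat) \<Rightarrow> nat \<Rightarrow> bool" where
  "is_antirecord n \<sigma> i \<longleftrightarrow> i \<in> {1..n} \<and> (\<forall>j\<in>{i<..n}. \<sigma> j > \<sigma> i)"

definition is_exclusive_antirecord :: "nat \<Rightarrow> (nat \<Rightarrow> nat) \<Rightarrow> nat \<Rightarrow> bool" where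
  "is_exclusive_antirecord n \<sigma> i \<longleftrightarrow> is_antirecord n \<sigma> i \<and> \<not> is_record n \<sigma> i"

definition is_cycle_peak :: "nat \<Rightarrow> (nat \<Rightarrow> nat) \<Rightarrow> nat \<Rightarrow> bool" where
  "is_cycle_peak n \<sigma> i \<longleftrightarrow> i \<in> {1..n} \<and> inv \<sigma> i < i \<and> i > \<sigma> i"

definition ear :: "nat \<Rightarrow> (nat \<Rightarrow> nat) \<Rightarrow> nat" where
  "ear n \<sigma> = card {i \<in> {1..n}. is_exclusive_antirecord n \<sigma> i \<and> is_cycle_peak n \<sigma> i}"

definition is_descent :: "nat \<Rightarrow> (nat \<Rightarrow> nat) \<Rightarrow> nat \<Rightarrow> bool" where
  "is_descent n \<sigma> i \<longleftrightarrow> i \<in> {1..<n} \<and> \<sigma> i > \<sigma> (i + 1)"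

definition des :: "nat \<Rightarrow> (nat \<Rightarrow> nat) \<Rightarrow> nat" where
  "des n \<sigma> = card {i \<in> {1..<n}. is_descent n \<sigma> i}"

definition des2 :: "nat \<Rightarrow> (nat \<Rightarrow> nat) \<Rightarrow> nat" where
  "des2 n \<sigma> = card {i \<in> {1..<n}. is_descent n \<sigma> i \<and> (\<forall>j\<in>{1..<i}. \<sigma> j < \<sigma> i)}"

definition is_double_ascent :: "nat \<Rightarrow> (nat \<Rightarrow> nat) \<Rightarrow> nat \<Rightarrow> bool" where
  "is_double_ascent n \<sigma> i \<longleftrightarrow>
     i \<in> {1..n} \<and> \<sigma> (i - 1) < \<sigma> i \<and> \<sigma> i < \<sigma> (i + 1)"

text \<open>Foremaxima are values \<open>\<sigma> i\<close>; they are counted here by their positions \<open>i\<close>.\<close>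

definition fmax :: "nat \<Rightarrow> (nat \<Rightarrow> nat) \<Rightarrow> nat" where
  "fmax n \<sigma> = card {i \<in> {1..n}. is_double_ascent n \<sigma> i \<and> is_record n \<sigma> i}"

end

theory Submission
  imports Defs
begin

text \<open>
  The coefficients of a J-fraction count weighted Motzkin paths, by the level recursion
  \<open>W (n+1) k = W n (k+1) + \<gamma>\<^sub>k W n k + \<beta>\<^sub>k W n (k-1)\<close>. For the weights at hand this array has the
  exponential generating functions \<open>c\<^sub>k F G^k\<close> where \<open>G' = (1 + G)(1 + tG)\<close>, \<open>G(0) = 0\<close> and
  \<open>F' = (w + \<lambda> t G) F\<close>, \<open>F(0) = 1\<close>; solving these equations gives the closed form.

  For the statistics of cycle type, a permutation of \<open>[n]\<close> is built up through its restrictions to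
  the squares \<open>[m] \<times> [m]\<close>, which are partial injections; the path level is the number of free rows.
  A down step closes a free row \<open>p\<close> and a free column \<open>v\<close> at a cycle peak, and each statistic marks
  exactly one column for every row: the least one (\<open>ear\<close>), the greatest one (\<open>pex\<close>, after reversal),
  or the starting point of the path that ends in \<open>p\<close> (\<open>pcyc\<close>).

  For the descent statistics, the letters of a word are weighted by power series such that
  inserting a new minimal letter in all possible ways amounts to differentiation.
\<close>

section \<open>Coefficients of Jacobi fractions\<close>

text \<open>Paths run from level \<open>k\<close> to level \<open>0\<close> in \<open>n\<close>
  steps and never go below \<open>0\<close>: up steps have weight 1, a level step at
  \<open>k\<close> has weight \<open>g k\<close>, a down step from \<open>k\<close> has weight
  \<open>b k\<close>. The recursion splits off the first step.\<close>

fun path_weight :: "(nat \<Rightarrow> 'a::comm_ring_1) \<Rightarrow> (nat \<Rightarrow> 'a) \<Rightarrow> nat \<Rightarrow> nat \<Rightarrow> 'a" where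
  "path_weight g b 0 k = (if k = 0 then 1 else 0)"
| "path_weight g b (Suc n) k =
     path_weight g b n (Suc k) + g k * path_weight g b n k
       + b k * (if k = 0 then 0 else path_weight g b n (k - 1))"

text \<open>Cutting a path from level \<open>k\<close> at its first visits to \<open>k - 1\<close>,
  ..., \<open>0\<close> gives one convergent per level. All factors are cut off at the same absolute
  height \<open>m\<close>, hence the lengths \<open>m - Suc k\<close>.\<close>

primrec level_series :: "(nat \<Rightarrow> 'a::field) \<Rightarrow> (nat \<Rightarrow> 'a) \<Rightarrow> nat \<Rightarrow> nat \<Rightarrow> 'a fps" where
  "level_series g b m 0 = J_convergent g b 0 m"
| "level_series g b m (Suc k) =
     fps_X * (fps_const (b (Suc k)) * level_series g b m k * J_convergent g b (Suc k) (m - Suc k))"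

text \<open>With denominator \<open>P\<close>, this is \<open>1/P = 1 + (1 - P)/P\<close>; since
  \<open>1 - P\<close> is divisible by \<open>fps_X\<close>, it acts as a recursion on
  coefficients.\<close>

lemma J_convergent_unfold:
  "J_convergent g b k (Suc m) =
     1 + fps_X * (fps_const (g k) * J_convergent g b k (Suc m)
       + fps_const (b (Suc k)) * fps_X * J_convergent g b (Suc k) m * J_convergent g b k (Suc m))"
proof -
  define P where "P = 1 - fps_const (g k) * fps_X
    - fps_const (b (Suc k)) * fps_X ^ 2 * J_convergent g b (Suc k) m"
  have P0: "fps_nth P 0 = 1" by (simp add: P_def fps_mult_nth)
  have J: "J_convergent g b k (Suc m) = inverse P"
    by (simp add: P_def[symmetric] fps_divide_unit P0)
  have "P * inverse P = 1" using P0 by (simp add: inverse_mult_eq_1')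
  then have "inverse P = 1 + (1 - P) * inverse P" by (simp add: algebra_simps)
  also have "1 - P = fps_X * (fps_const (g k)
      + fps_const (b (Suc k)) * fps_X * J_convergent g b (Suc k) m)"
    by (simp add: P_def algebra_simps power2_eq_square)
  finally show ?thesis unfolding J by (simp only: algebra_simps)
qed

text \<open>Only the factor of level \<open>k\<close> is expanded, by
  \<open>J_convergent_unfold\<close>; \<open>k < m\<close> ensures that it is not the zero
  convergent. The three terms are the possible first steps of a path.\<close>

lemma level_series_rec:
  assumes "k < m"
  shows "level_series g b m k = (if k = 0 then 1 else 0) + fps_X * (level_series g b m (Suc k)
    + fps_const (g k) * level_series g b m k
    + fps_const (b k) * (if k = 0 then 0 else level_series g b m (k - 1)))"
proof -
  obtain l where l: "m - k = Suc l" "m - Suc k = l" using assms by (metis Suc_diff_Suc)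
  note J = J_convergent_unfold[of g b k l]
  show ?thesis
  proof (cases k)
    case 0
    then show ?thesis using J l by (simp del: J_convergent.simps add: algebra_simps)
  next
    case (Suc k')
    define Q where "Q = J_convergent g b (Suc k') (Suc l)"
    have Q: "Q = 1 + fps_X * (fps_const (g k) * Q
       + fps_const (b (Suc k)) * fps_X * J_convergent g b (Suc k) l * Q)"
      using J unfolding Q_def Suc .
    have V: "level_series g b m k = fps_X * (fps_const (b k) * level_series g b m k' * Q)"
      using l by (simp add: Suc Q_def del: J_convergent.simps)
    also have "\<dots> = fps_X * (fps_const (b k) * level_series g b m k' * (1 + fps_X * (fps_const (g k) * Q
       + fps_const (b (Suc k)) * fps_X * J_convergent g b (Suc k) l * Q)))"
      using Q by simp
    also have "\<dots> = fps_X * (fps_X * (fps_const (b (Suc k)) *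
         (fps_X * (fps_const (b k) * level_series g b m k' * Q)) * J_convergent g b (Suc k) l)
         + fps_const (g k) * (fps_X * (fps_const (b k) * level_series g b m k' * Q))
         + fps_const (b k) * level_series g b m k')"
      by (simp only: algebra_simps mult_1_left)
    also have "\<dots> = fps_X * (level_series g b m (Suc k)
         + fps_const (g k) * level_series g b m k + fps_const (b k) * level_series g b m k')"
      unfolding V[symmetric] using l by simp
    finally show ?thesis using Suc by simp
  qed
qed

text \<open>Each use of \<open>level_series_rec\<close> lowers \<open>n\<close> by one and raises
  \<open>k\<close> by at most one, so the bound is preserved: a path this short never meets the
  cutoff at height \<open>m\<close>.\<close>

lemma level_series_nth:
  assumes "n + k < m"
  shows "fps_nth (level_series g b m k) n = path_weight g b n k"
  using assms
proof (induction n arbitrary: k)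
  case 0
  then show ?case by (subst level_series_rec) auto
next
  case (Suc n)
  then show ?case by (subst level_series_rec) (auto simp del: level_series.simps)
qed

lemma J_fraction_nth: "fps_nth (J_fraction g b) n = path_weight g b n 0"
proof -
  have "eventually (\<lambda>m. fps_nth (J_convergent g b 0 m) n = fps_nth (J_fraction g b) n) sequentially"
    using J_convergent_LIMSEQ[of g b] by (simp add: tendsto_fps_iff)
  moreover have "eventually (\<lambda>m. n < m) sequentially" by (rule eventually_gt_at_top)
  ultimately have "eventually (\<lambda>m. fps_nth (J_fraction g b) n = path_weight g b n 0) sequentially"
  proof eventually_elim
    case (elim m)
    then show ?case using level_series_nth[of n 0 m g b] by simp
  qed
  then show ?thesis by simp
qed

abbreviation jac_gamma :: "'a::field_char_0 \<Rightarrow> 'a \<Rightarrow> nat \<Rightarrow> 'a" where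
  "jac_gamma t w \<equiv> \<lambda>k. w + of_nat k * (t + 1)"

abbreviation jac_beta :: "'a::field_char_0 \<Rightarrow> 'a \<Rightarrow> nat \<Rightarrow> 'a" where
  "jac_beta t lam \<equiv> \<lambda>k. of_nat k * t * (lam + of_nat k - 1)"

lemma B_eq_path_weight: "B n t lam w = path_weight (jac_gamma t w) (jac_beta t lam) n 0"
  by (simp add: B_def J_fraction_nth)

text \<open>The constant terms of the \<open>n\<close>-th derivatives of the \<open>E k\<close> obey
  the recursion of \<open>path_weight\<close>, because one more differentiation amounts to one more
  first step.\<close>

lemma path_weight_egf:
  fixes E :: "nat \<Rightarrow> 'a::field_char_0 fps"
  assumes zero: "\<And>k. fps_nth (E k) 0 = (if k = 0 then 1 else 0)"
    and deriv: "\<And>k. fps_deriv (E k) = E (Suc k) + fps_const (g k) * E k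
      + fps_const (b k) * (if k = 0 then 0 else E (k - 1))"
  shows "path_weight g b n k = fact n * fps_nth (E k) n"
proof -
  have "path_weight g b n k = fps_nth ((fps_deriv ^^ n) (E k)) 0"
  proof (induction n arbitrary: k)
    case 0
    then show ?case by (simp add: zero)
  next
    case (Suc n)
    have lin: "(fps_deriv ^^ n) (x + fps_const c * y + fps_const d * z) = (fps_deriv ^^ n) x
      + fps_const c * (fps_deriv ^^ n) y + fps_const d * (fps_deriv ^^ n) z"
      for x y z :: "'a fps" and c d
      by (induction n) simp_all
    have z: "(fps_deriv ^^ n) (0::'a fps) = 0" by (induction n) simp_all
    show ?case
      unfolding funpow_Suc_right o_apply deriv lin by (simp add: Suc.IH z)
  qed
  then show ?thesis by (simp add: fps_0th_higher_deriv)
qed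

section \<open>The exponential generating function\<close>

text \<open>
  \<open>S = (e^((t-1)z) - 1) / (t - 1)\<close>, in a form that also makes sense for \<open>t = 1\<close>.
\<close>

definition S_series :: "'a::field_char_0 \<Rightarrow> 'a fps" where
  "S_series t = fps_integral0 (fps_exp (t - 1))"

definition G_series :: "'a::field_char_0 \<Rightarrow> 'a fps" where
  "G_series t = S_series t * inverse (1 - S_series t)"

lemma S_series_0 [simp]: "fps_nth (S_series t) 0 = 0"
  by (simp add: S_series_def)

lemma S_series_exp: "fps_exp (t - 1) = 1 + fps_const (t - 1) * S_series t"
proof -
  have "fps_deriv (fps_exp (t - 1)) = fps_deriv (1 + fps_const (t - 1) * S_series t)"
    by (simp add: S_series_def fps_deriv_fps_integral)
  then show ?thesis unfolding fps_deriv_eq_iff by simp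
qed

lemma deriv_S_series: "fps_deriv (S_series t) = 1 + fps_const (t - 1) * S_series t"
  by (simp add: S_series_exp[symmetric] del: fps_const_sub) (simp add: S_series_def fps_deriv_fps_integral)

lemma one_minus_S_inverse: "(1 - S_series t) * inverse (1 - S_series t) = 1"
  by (simp add: inverse_mult_eq_1')

lemma G_series_0 [simp]: "fps_nth (G_series t) 0 = 0"
  by (simp add: G_series_def)

text \<open>Here \<open>1 + G = 1/(1 - S)\<close> and
  \<open>1 + t G = (1 + (t - 1) S)/(1 - S)\<close>; the product is \<open>S'/(1 - S)^2\<close>,
  which is \<open>G'\<close>.\<close>

lemma deriv_G_series:
  "fps_deriv (G_series t) = (1 + G_series t) * (1 + fps_const t * G_series t)"
proof -
  define S where "S = S_series t"
  define I where "I = inverse (1 - S)"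
  have I: "(1 - S) * I = 1" using one_minus_S_inverse[of t] by (simp add: S_def I_def)
  have S': "fps_deriv S = 1 + (fps_const t - 1) * S"
    using deriv_S_series[of t] by (simp add: S_def algebra_simps flip: fps_const_sub)
  have "fps_deriv ((1 - S) * I) = 0" using I by simp
  then have "(1 - S) * fps_deriv I = fps_deriv S * I" by (simp add: algebra_simps)
  then have "((1 - S) * I) * fps_deriv I = fps_deriv S * I * I" by (simp add: mult_ac)
  then have I': "fps_deriv I = fps_deriv S * I * I" using I by simp
  have "fps_deriv (S * I) = fps_deriv S * I * (S * I) + fps_deriv S * I"
    by (simp add: I' algebra_simps)
  also have "\<dots> = (1 + S * I) * (1 + fps_const t * (S * I))"
    unfolding S' using I by algebra
  finally show ?thesis by (simp add: G_series_def S_def I_def)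
qed

text \<open>This describes the generating function without dividing by \<open>1 - t\<close>, so that
  it is also available at \<open>t = 1\<close>, as the descent formula requires.\<close>

definition EGF_ode :: "'a::field_char_0 \<Rightarrow> 'a \<Rightarrow> 'a \<Rightarrow> 'a fps \<Rightarrow> bool" where
  "EGF_ode t lam w F \<longleftrightarrow> fps_nth F 0 = 1 \<and>
     fps_deriv F = (fps_const w + fps_const lam * fps_const t * G_series t) * F"

lemma B_egf:
  assumes "EGF_ode t lam w F"
  shows "B n t lam w = fact n * fps_nth F n"
proof -
  define G where "G = G_series t"
  \<comment> \<open>In the derivative of \<open>E k\<close>, the term \<open>F * G^(k+1)\<close>
    gets the factor \<open>c k * t * (lam + k)\<close>, which has to be \<open>c (k+1)\<close>. The
    factor \<open>k * c k\<close> of \<open>F * G^(k-1)\<close> then equals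
    \<open>jac_beta t lam k * c (k-1)\<close>.\<close>
  define c where "c k = (\<Prod>i<k. t * (lam + of_nat i))" for k
  define E where "E k = fps_const (c k) * (F * G ^ k)" for k
  have F0: "fps_nth F 0 = 1"
    and F': "fps_deriv F = (fps_const w + fps_const lam * fps_const t * G) * F"
    using assms by (auto simp: EGF_ode_def G_def)
  have G': "fps_deriv G = (1 + G) * (1 + fps_const t * G)"
    unfolding G_def by (rule deriv_G_series)
  have "path_weight (jac_gamma t w) (jac_beta t lam) n 0 = fact n * fps_nth (E 0) n"
  proof (rule path_weight_egf)
    fix k
    show "fps_nth (E k) 0 = (if k = 0 then 1 else 0)"
      by (simp add: E_def F0 G_def c_def fps_nth_power_0)
    show "fps_deriv (E k) = E (Suc k) + fps_const (w + of_nat k * (t + 1)) * E k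
      + fps_const (of_nat k * t * (lam + of_nat k - 1)) * (if k = 0 then 0 else E (k - 1))"
    proof (cases k)
      case 0
      then show ?thesis
        by (simp add: E_def c_def F' algebra_simps flip: fps_const_mult)
    next
      case (Suc l)
      define K L T u :: "'a fps" where "K = of_nat (Suc l)" and "L = fps_const lam"
        and "T = fps_const t" and "u = fps_const (c l)"
      have K: "fps_const (of_nat (Suc l)) = K" unfolding K_def by (rule fps_of_nat)
      have k': "fps_const (of_nat k * t * (lam + of_nat k - 1)) = K * T * (L + K - 1)"
        unfolding Suc K[symmetric] T_def L_def by (simp flip: fps_const_1_eq_1)
      have g': "fps_const (w + of_nat k * (t + 1)) = fps_const w + K * (T + 1)"
        unfolding Suc K[symmetric] T_def by (simp flip: fps_const_1_eq_1)
      have c1: "fps_const (c (Suc l)) = u * T * (L + K - 1)"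
        unfolding K[symmetric] T_def L_def u_def c_def by (simp flip: fps_const_1_eq_1)
      have c2: "fps_const (c (Suc (Suc l))) = u * T * (L + K - 1) * T * (L + K)"
        unfolding K[symmetric] T_def L_def u_def c_def by (simp flip: fps_const_1_eq_1)
      have dG: "fps_deriv (G ^ Suc l) = K * ((1 + G) * (1 + T * G)) * G ^ l"
        unfolding fps_deriv_power G' T_def K[symmetric] by simp
      have E1: "E (Suc l) = u * T * (L + K - 1) * (F * G ^ Suc l)" unfolding E_def c1 ..
      have E2: "E (Suc (Suc l)) = u * T * (L + K - 1) * T * (L + K) * (F * G ^ Suc (Suc l))"
        unfolding E_def c2 ..
      have "fps_deriv (E (Suc l)) = fps_const (c (Suc l)) * (fps_deriv F * G ^ Suc l + F * fps_deriv (G ^ Suc l))"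
        unfolding E_def by simp
      also have "\<dots> = u * T * (L + K - 1) * T * (L + K) * (F * G ^ Suc (Suc l))
        + (fps_const w + K * (T + 1)) * (u * T * (L + K - 1) * (F * G ^ Suc l))
        + K * T * (L + K - 1) * (u * (F * G ^ l))"
        unfolding dG c1 F' T_def[symmetric] L_def[symmetric]
        unfolding power_Suc by (simp only: algebra_simps mult_1_left)
      finally show ?thesis
        unfolding k' g' unfolding Suc E2 E1 by (simp add: E_def u_def)
    qed
  qed
  then show ?thesis by (simp add: B_eq_path_weight E_def c_def)
qed

text \<open>A linear equation of first order is solved by the exponential of an antiderivative of
  its coefficient; this works for every \<open>t\<close>.\<close>

lemma EGF_ode_exists: "\<exists>F. EGF_ode t lam w F"
proof -
  define H where "H = fps_const w + fps_const lam * fps_const t * G_series t"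
  have "EGF_ode t lam w (fps_exp 1 oo fps_integral0 H)"
    unfolding EGF_ode_def H_def[symmetric]
    by (simp add: fps_compose_deriv fps_deriv_fps_integral mult.commute)
  then show ?thesis ..
qed

text \<open>Logarithmic differentiation: \<open>fps_log f\<close> has derivative
  \<open>f'/f\<close>. Constant term 1 makes \<open>f - 1\<close> admissible in the
  compositions.\<close>

lemma deriv_fps_pow:
  fixes f :: "'a::field_char_0 fps"
  assumes "fps_nth f 0 = 1"
  shows "fps_deriv (fps_pow f a) = fps_const a * fps_deriv f * inverse f * fps_pow f a"
proof -
  have f: "fps_nth (f - 1) 0 = 0" using assms by simp
  have "inverse (1 + fps_X) oo (f - 1) = inverse ((1 + fps_X) oo (f - 1))"
    using f by (intro fps_inverse_compose) auto
  also have "(1 + fps_X) oo (f - 1) = f" using f by (simp add: fps_compose_add_distrib)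
  finally have "fps_deriv (fps_log f) = inverse f * fps_deriv f"
    unfolding fps_log_def by (simp add: fps_compose_deriv[OF f] fps_ln_deriv)
  then show ?thesis
    unfolding fps_pow_def
    by (subst fps_compose_deriv) (simp_all add: fps_log_def mult_ac)
qed

text \<open>Since \<open>e^(tz) = e^z (1 + (t - 1) S)\<close>, the denominator is
  \<open>N = (1 - t) e^z (1 - S)\<close> and satisfies \<open>N' = - t G N\<close>. Its quotient
  \<open>D = (1 - t)/N\<close> therefore has logarithmic derivative \<open>t G\<close>; the power
  \<open>lam\<close> multiplies this by \<open>lam\<close>, and \<open>fps_exp w\<close> adds
  \<open>w\<close>.\<close>

lemma EGF_ode_explicit:
  fixes t lam w :: "'a::field_char_0"
  assumes "t \<noteq> 1"
  shows "EGF_ode t lam w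
    (fps_exp w * fps_pow (fps_const (1 - t) / (fps_exp t - fps_const t * fps_exp 1)) lam)"
proof -
  define T where "T = fps_const t"
  define S I where "S = S_series t" and "I = inverse (1 - S_series t)"
  have I: "(1 - S) * I = 1" using one_minus_S_inverse[of t] by (simp add: S_def I_def)
  define e where "e = fps_exp (1::'a)"
  define N where "N = fps_exp t - fps_const t * fps_exp 1"
  define D where "D = fps_const (1 - t) / N"
  have et: "fps_exp t = e * (1 + (T - 1) * S)"
  proof -
    have "fps_exp t = fps_exp 1 * fps_exp (t - 1)" by (simp flip: fps_exp_add_mult)
    then show ?thesis by (simp add: S_series_exp S_def e_def T_def flip: fps_const_sub)
  qed
  have N: "N = (1 - T) * (e * (1 - S))"
    unfolding N_def et e_def[symmetric] T_def[symmetric] by (simp add: algebra_simps)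
  have N': "fps_deriv N = T * (fps_exp t - e)"
    by (simp add: N_def T_def e_def algebra_simps)
  have N0: "fps_nth N 0 = 1 - t" by (simp add: N_def)
  have NI: "N * inverse N = 1" using N0 assms by (simp add: inverse_mult_eq_1')
  have D: "D = fps_const (1 - t) * inverse N"
    unfolding D_def using N0 assms by (simp add: fps_divide_unit)
  have D0: "fps_nth D 0 = 1" using assms by (simp add: D N0)
  have DI: "D * inverse D = 1" using D0 by (simp add: inverse_mult_eq_1')
  have ND: "N * D = fps_const (1 - t)" using NI by (simp add: D mult_ac)
  have "fps_deriv (N * D) = 0" unfolding ND by simp
  then have nd: "N * fps_deriv D = - (fps_deriv N * D)" by (simp add: add_eq_0_iff add.commute mult.commute)
  have N'': "fps_deriv N = - (N * (T * (S * I)))"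
  proof -
    have "N * (T * (S * I)) = (1 - T) * e * T * S * ((1 - S) * I)"
      unfolding N by (simp only: mult_ac)
    then show ?thesis unfolding N' et I by (simp add: algebra_simps)
  qed
  have "fps_deriv D = (N * inverse N) * fps_deriv D" by (simp add: NI)
  also have "\<dots> = inverse N * (N * fps_deriv D)" by (simp add: mult_ac)
  also have "\<dots> = (N * inverse N) * (T * (S * I)) * D" unfolding nd N'' by (simp add: mult_ac)
  finally have D': "fps_deriv D = T * (S * I) * D" by (simp add: NI)
  have "fps_deriv (fps_pow D lam) = fps_const lam * (T * (S * I)) * (D * inverse D) * fps_pow D lam"
    unfolding deriv_fps_pow[OF D0] D' by (simp only: mult_ac)
  then have "fps_deriv (fps_pow D lam) = fps_const lam * T * G_series t * fps_pow D lam"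
    unfolding DI by (simp add: G_series_def S_def I_def mult_ac)
  then have "fps_deriv (fps_exp w * fps_pow D lam) =
    (fps_const w + fps_const lam * T * G_series t) * (fps_exp w * fps_pow D lam)"
    by (simp add: algebra_simps)
  moreover have "fps_nth (fps_pow D lam) 0 = 1" by (simp add: fps_pow_def)
  ultimately show ?thesis
    unfolding D_def N_def T_def by (simp add: EGF_ode_def)
qed

section \<open>Descent statistics\<close>

lemma power_card_filter:
  fixes x :: "'a::comm_monoid_mult"
  assumes "finite S"
  shows "x ^ card {i \<in> S. P i} = (\<Prod>i\<in>S. if P i then x else 1)"
  using assms by (subst prod.inter_filter[symmetric]) simp_all

text \<open>
  The letters are weighted by \<open>ra\<close>, \<open>rd\<close>, \<open>na\<close>, \<open>nd\<close> according to whether they are records (with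
  respect to \<open>m\<close> and the preceding letters) and followed by a smaller letter; the last letter counts
  as an ascent.
\<close>

fun word_wt :: "'b::comm_ring_1 \<Rightarrow> 'b \<Rightarrow> 'b \<Rightarrow> 'b \<Rightarrow> nat \<Rightarrow> nat list \<Rightarrow> 'b" where
  "word_wt ra rd na nd m [] = 1"
| "word_wt ra rd na nd m (x # ys) =
     (if m < x then (if ys \<noteq> [] \<and> hd ys < x then rd else ra)
      else (if ys \<noteq> [] \<and> hd ys < x then nd else na)) * word_wt ra rd na nd (max m x) ys"

text \<open>Insertion in front of the word is left out, as no letter would be changed by it; in
  \<open>sum_word_wt_deriv\<close> that case comes from the derivative of the prefactor
  \<open>F\<close>.\<close>

fun ins_after :: "'b \<Rightarrow> 'b list \<Rightarrow> 'b list list" where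
  "ins_after a [] = []"
| "ins_after a (x # ys) = (x # a # ys) # map ((#) x) (ins_after a ys)"

lemma hd_ins_after: "zs \<in> set (ins_after a ys) \<Longrightarrow> ys \<noteq> [] \<and> zs \<noteq> [] \<and> hd zs = hd ys"
  by (cases ys) auto

lemma mset_ins_after: "zs \<in> set (ins_after a ys) \<Longrightarrow> mset zs = add_mset a (mset ys)"
  by (induction ys arbitrary: zs) auto

lemma distinct_ins_after: "a \<notin> set ys \<Longrightarrow> distinct (ins_after a ys)"
proof (induction ys)
  case (Cons y ys)
  then show ?case using hd_ins_after[of "a # ys" a ys] by (auto simp: distinct_map)
qed simp

lemma remove1_eq_iff_ins_after:
  assumes "a \<notin> set ys"
  shows "a \<in> set xs \<and> remove1 a xs = ys \<longleftrightarrow> xs = a # ys \<or> xs \<in> set (ins_after a ys)"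
  using assms
proof (induction xs arbitrary: ys)
  case Nil
  then show ?case using hd_ins_after[of "[]" a ys] by auto
next
  case (Cons x xs)
  show ?case
  proof (cases "x = a")
    case True
    then have "x # xs \<notin> set (ins_after a ys)"
      using hd_ins_after[of "x # xs" a ys] Cons.prems by (metis hd_in_set list.sel(1))
    then show ?thesis using True by auto
  next
    case False
    then show ?thesis using Cons by (cases ys) auto
  qed
qed

text \<open>The words are grouped by what remains after deleting \<open>a\<close>. The fibre over
  \<open>ys\<close> consists of all insertions of \<open>a\<close> into \<open>ys\<close>, each
  arising once because \<open>a\<close> does not occur in \<open>ys\<close>.\<close>

lemma sum_permutations_of_set_insert:
  fixes f :: "'b list \<Rightarrow> 'c::comm_monoid_add"
  assumes "finite A" "a \<notin> A"
  shows "sum f (permutations_of_set (insert a A)) =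
    (\<Sum>ys\<in>permutations_of_set A. f (a # ys) + sum_list (map f (ins_after a ys)))"
proof -
  have "sum f (permutations_of_set (insert a A)) = (\<Sum>ys\<in>permutations_of_set A.
      sum f {xs \<in> permutations_of_set (insert a A). remove1 a xs = ys})"
    using assms by (intro sum.group[symmetric] finite_permutations_of_set)
      (auto simp: permutations_of_set_def)
  also have "\<dots> = (\<Sum>ys\<in>permutations_of_set A. f (a # ys) + sum_list (map f (ins_after a ys)))"
  proof (rule sum.cong[OF refl])
    fix ys assume ys: "ys \<in> permutations_of_set A"
    then have a: "a \<notin> set ys" using assms by (auto simp: permutations_of_set_def)
    have mem: "xs \<in> permutations_of_set (insert a A)" if "mset xs = mset (a # ys)" for xs
      using that ys a mset_eq_setD[OF that] mset_eq_imp_distinct_iff[OF that]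
      by (auto simp: permutations_of_set_def)
    have "{xs \<in> permutations_of_set (insert a A). remove1 a xs = ys}
        = insert (a # ys) (set (ins_after a ys))"
    proof (intro set_eqI iffI)
      fix xs assume xs: "xs \<in> {xs \<in> permutations_of_set (insert a A). remove1 a xs = ys}"
      then have "a \<in> set xs" by (simp add: permutations_of_set_def)
      then show "xs \<in> insert (a # ys) (set (ins_after a ys))"
        using remove1_eq_iff_ins_after[OF a, of xs] xs by blast
    next
      fix xs assume xs: "xs \<in> insert (a # ys) (set (ins_after a ys))"
      then have "remove1 a xs = ys" using remove1_eq_iff_ins_after[OF a, of xs] by blast
      moreover have "mset xs = mset (a # ys)" using xs mset_ins_after[of xs a ys] by auto
      ultimately show "xs \<in> {xs \<in> permutations_of_set (insert a A). remove1 a xs = ys}"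
        using mem by blast
    qed
    moreover have "a # ys \<notin> set (ins_after a ys)"
      using hd_ins_after[of "a # ys" a ys] a by (metis hd_in_set list.sel(1))
    ultimately show "sum f {xs \<in> permutations_of_set (insert a A). remove1 a xs = ys}
        = f (a # ys) + sum_list (map f (ins_after a ys))"
      using distinct_ins_after[OF a] by (simp add: sum_list_distinct_conv_sum_set)
  qed
  finally show ?thesis .
qed

text \<open>
  A minimal letter \<open>a\<close> inserted after \<open>x\<close> is a non-record ascent, it turns \<open>x\<close> into a descent and
  leaves all other types unchanged.
\<close>

lemma deriv_word_wt:
  fixes ra rd na nd :: "'a::field fps"
  assumes "fps_deriv ra = rd * na" "fps_deriv rd = rd * na"
    and "fps_deriv na = nd * na" "fps_deriv nd = nd * na"
    and "\<forall>x\<in>set xs. a < x"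
  shows "fps_deriv (word_wt ra rd na nd m xs)
    = sum_list (map (word_wt ra rd na nd m) (ins_after a xs))"
  using assms(5)
proof (induction xs arbitrary: m)
  case (Cons x ys)
  define c where "c = (if m < x then (if ys \<noteq> [] \<and> hd ys < x then rd else ra)
      else (if ys \<noteq> [] \<and> hd ys < x then nd else na))"
  have "map (word_wt ra rd na nd m) (map ((#) x) (ins_after a ys))
      = map (\<lambda>zs. c * word_wt ra rd na nd (max m x) zs) (ins_after a ys)"
    unfolding c_def by (auto dest: hd_ins_after)
  then have "sum_list (map (word_wt ra rd na nd m) (map ((#) x) (ins_after a ys)))
      = sum_list (map (\<lambda>zs. c * word_wt ra rd na nd (max m x) zs) (ins_after a ys))"
    by (rule arg_cong)
  moreover have IH: "fps_deriv (word_wt ra rd na nd (max m x) ys)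
      = sum_list (map (word_wt ra rd na nd (max m x)) (ins_after a ys))"
    using Cons by simp
  ultimately have "sum_list (map (word_wt ra rd na nd m) (map ((#) x) (ins_after a ys)))
      = c * fps_deriv (word_wt ra rd na nd (max m x) ys)"
    by (simp only: sum_list_const_mult)
  moreover have "word_wt ra rd na nd m (x # a # ys) = fps_deriv c * word_wt ra rd na nd (max m x) ys"
  proof -
    have "a < x" "\<not> (ys \<noteq> [] \<and> hd ys < a)" "max (max m x) a = max m x" "\<not> max m x < a"
      using Cons.prems by (auto simp: max_def intro!: hd_in_set) (metis hd_in_set less_asym)
    then show ?thesis unfolding c_def by (auto simp: assms(1-4) mult_ac)
  qed
  moreover have "word_wt ra rd na nd m (x # ys) = c * word_wt ra rd na nd (max m x) ys"
    by (simp add: c_def)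
  ultimately show ?case by (simp del: word_wt.simps map_map add: mult.commute add.commute)
qed simp

lemma word_wt_start:
  assumes "\<forall>x\<in>set xs. m < x \<and> m' < x"
  shows "word_wt ra rd na nd m xs = word_wt ra rd na nd m' xs"
  using assms by (cases xs) (auto simp: max_def)

lemma word_wt_nth_0:
  fixes ra rd na nd :: "'a::field fps"
  shows "fps_nth (word_wt ra rd na nd m xs) 0
    = word_wt (fps_nth ra 0) (fps_nth rd 0) (fps_nth na 0) (fps_nth nd 0) m xs"
  by (induction xs arbitrary: m) auto

text \<open>Letters are inserted in decreasing order, so each new one is minimal. By the product
  rule, \<open>F' = ra * F\<close> accounts for the new letter in front, where it is a record and an
  ascent, and the derivatives of the word weights account for all other positions.\<close>

lemma sum_word_wt_deriv:
  fixes F ra rd na nd :: "'a::field fps"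
  assumes "fps_deriv ra = rd * na" "fps_deriv rd = rd * na"
    and "fps_deriv na = nd * na" "fps_deriv nd = nd * na"
    and "fps_deriv F = ra * F"
    and "finite A" "0 \<notin> A"
  shows "F * (\<Sum>xs\<in>permutations_of_set A. word_wt ra rd na nd 0 xs) = (fps_deriv ^^ card A) F"
  using assms(6,7)
proof (induction A rule: finite_linorder_min_induct)
  case (insert a A)
  let ?wt = "word_wt ra rd na nd 0"
  have a: "a \<notin> A" "0 < a" using insert by auto
  have cons: "?wt (a # ys) = ra * ?wt ys" if "ys \<in> permutations_of_set A" for ys
  proof -
    have ys: "\<forall>x\<in>set ys. a < x" using that insert by (auto simp: permutations_of_set_def)
    then have "\<not> (ys \<noteq> [] \<and> hd ys < a)" by (metis hd_in_set less_asym)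
    moreover have "word_wt ra rd na nd a ys = ?wt ys"
      using ys by (intro word_wt_start) auto
    ultimately show ?thesis using a by auto
  qed
  have "(fps_deriv ^^ card (insert a A)) F = fps_deriv (F * sum ?wt (permutations_of_set A))"
    using insert a by simp
  also have "\<dots> = F * (ra * sum ?wt (permutations_of_set A) + (\<Sum>ys\<in>permutations_of_set A. fps_deriv (?wt ys)))"
    using assms(5) by (simp add: algebra_simps fps_deriv_sum)
  also have "ra * sum ?wt (permutations_of_set A) + (\<Sum>ys\<in>permutations_of_set A. fps_deriv (?wt ys))
    = (\<Sum>ys\<in>permutations_of_set A. ?wt (a # ys) + sum_list (map ?wt (ins_after a ys)))"
    unfolding sum.distrib sum_distrib_left using insert.hyps cons
    by (intro arg_cong2[of _ _ _ _ "(+)"] sum.cong refl deriv_word_wt[OF assms(1-4)])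
      (auto simp: permutations_of_set_def)
  also have "\<dots> = sum ?wt (permutations_of_set (insert a A))"
    using insert.hyps a by (intro sum_permutations_of_set_insert[symmetric]) auto
  finally show ?case by simp
qed simp

lemma B_eq_sum_words:
  fixes t lam w :: "'a::field_char_0"
  shows "B n t lam w = (\<Sum>xs\<in>permutations_of_set {1..n}. word_wt w (lam * t) 1 t 0 xs)"
proof -
  obtain F where F: "EGF_ode t lam w F" using EGF_ode_exists by blast
  define L T G where "L = fps_const lam" and "T = fps_const t" and "G = G_series t"
  \<comment> \<open>\<open>ra\<close> is the logarithmic derivative of \<open>F\<close>. All four
    series are affine in \<open>G\<close>, and the factorisation of \<open>G'\<close> splits their
    derivatives into the products \<open>rd * na\<close> and \<open>nd * na\<close>.\<close>
  define ra rd na nd where "ra = fps_const w + L * T * G" and "rd = L * T * (1 + G)"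
    and "na = 1 + T * G" and "nd = T * (1 + G)"
  have G': "fps_deriv G = (1 + G) * (1 + T * G)"
    unfolding G_def T_def by (rule deriv_G_series)
  have T': "fps_deriv T = 0" "fps_deriv L = 0" by (simp_all add: T_def L_def)
  have "fps_deriv F = ra * F" using F by (simp add: EGF_ode_def ra_def L_def T_def G_def)
  then have "F * (\<Sum>xs\<in>permutations_of_set {1..n}. word_wt ra rd na nd 0 xs)
      = (fps_deriv ^^ card {1..n}) F"
    by (intro sum_word_wt_deriv) (auto simp: ra_def rd_def na_def nd_def G' T' algebra_simps)
  then have "fps_nth (F * (\<Sum>xs\<in>permutations_of_set {1..n}. word_wt ra rd na nd 0 xs)) 0
      = fact n * fps_nth F n"
    by (simp add: fps_0th_higher_deriv)
  \<comment> \<open>\<open>G\<close> vanishes at \<open>z = 0\<close>, where the series thus become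
    the plain weights of the four types of letters.\<close>
  moreover have "fps_nth ra 0 = w" "fps_nth rd 0 = lam * t" "fps_nth na 0 = 1" "fps_nth nd 0 = t"
    by (simp_all add: ra_def rd_def na_def nd_def L_def T_def G_def)
  ultimately show ?thesis
    using F by (simp add: EGF_ode_def B_egf[OF F] fps_sum_nth word_wt_nth_0)
qed

section \<open>From words back to permutations of \<open>{1..n}\<close>\<close>

lemma word_wt_eq_prod:
  "word_wt ra rd na nd m xs = (\<Prod>i<length xs.
     if m < xs ! i \<and> (\<forall>j<i. xs ! j < xs ! i)
     then (if Suc i < length xs \<and> xs ! Suc i < xs ! i then rd else ra)
     else (if Suc i < length xs \<and> xs ! Suc i < xs ! i then nd else na))"
proof (induction xs arbitrary: m)
  case (Cons x ys)
  show ?case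
    unfolding length_Cons prod.lessThan_Suc_shift word_wt.simps Cons.IH
    by (intro arg_cong2[of _ _ _ _ "(*)"] prod.cong)
      (auto simp: All_less_Suc2 hd_conv_nth)
qed simp

text \<open>Surjectivity follows by counting: source and target have the same finite
  cardinality.\<close>

lemma bij_betw_permutes_words:
  "bij_betw (\<lambda>\<sigma>. map \<sigma> [1..<Suc n]) {\<sigma>. \<sigma> permutes {1..n}} (permutations_of_set {1..n})"
proof -
  let ?f = "\<lambda>\<sigma>::nat\<Rightarrow>nat. map \<sigma> [1..<Suc n]"
  have set: "set [1..<Suc n] = {1..n}" by auto
  have inj: "inj_on ?f {\<sigma>. \<sigma> permutes {1..n}}"
  proof (rule inj_onI)
    fix \<sigma> \<tau> assume *: "\<sigma> \<in> {\<sigma>. \<sigma> permutes {1..n}}" "\<tau> \<in> {\<sigma>. \<sigma> permutes {1..n}}" "?f \<sigma> = ?f \<tau>"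
    then have "\<sigma> i = \<tau> i" if "i \<in> {1..n}" for i using that set by (metis map_eq_conv)
    then show "\<sigma> = \<tau>" using * by (metis ext mem_Collect_eq permutes_not_in)
  qed
  moreover have "?f ` {\<sigma>. \<sigma> permutes {1..n}} \<subseteq> permutations_of_set {1..n}"
  proof safe
    fix \<sigma> assume s: "\<sigma> permutes {1..n}"
    have "distinct (?f \<sigma>)" unfolding distinct_map set
      using permutes_inj_on[OF s] by simp
    moreover have "set (?f \<sigma>) = {1..n}" unfolding set_map set by (rule permutes_image[OF s])
    ultimately show "?f \<sigma> \<in> permutations_of_set {1..n}" by (rule permutations_of_setI[rotated])
  qed
  moreover have "card (?f ` {\<sigma>. \<sigma> permutes {1..n}}) = card (permutations_of_set {1..n})"
    by (subst card_image[OF inj]) (simp add: card_permutations)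
  ultimately show ?thesis
    by (simp add: bij_betw_def card_subset_eq)
qed

lemma word_wt_permutes:
  assumes s: "\<sigma> permutes {1..n}"
  shows "word_wt w (lam * t) 1 t 0 (map \<sigma> [1..<Suc n]) = t ^ des n \<sigma> * lam ^ des2 n \<sigma> * w ^ fmax n \<sigma>"
proof -
  have pos: "0 < \<sigma> i" if "i \<in> {1..n}" for i using permutes_in_image[OF s, of i] that by simp
  have zero: "\<sigma> 0 = 0" and last: "\<sigma> (Suc n) = Suc n" by (simp_all add: permutes_not_in[OF s])
  have des: "t ^ des n \<sigma> = (\<Prod>i\<in>{1..n}. if is_descent n \<sigma> i then t else 1)"
    by (subst power_card_filter[symmetric])
      (auto simp: des_def is_descent_def intro!: arg_cong[of _ _ "\<lambda>A. t ^ card A"])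
  have des2: "lam ^ des2 n \<sigma> = (\<Prod>i\<in>{1..n}. if is_descent n \<sigma> i \<and> is_record n \<sigma> i then lam else 1)"
    by (subst power_card_filter[symmetric])
      (auto simp: des2_def is_descent_def is_record_def intro!: arg_cong[of _ _ "\<lambda>A. lam ^ card A"])
  have rec: "(0 < \<sigma> (Suc i) \<and> (\<forall>j<i. \<sigma> (Suc j) < \<sigma> (Suc i))) = is_record n \<sigma> (Suc i)" if "i < n" for i
  proof -
    have "(\<forall>j<i. \<sigma> (Suc j) < \<sigma> (Suc i)) = (\<forall>j\<in>{1..<Suc i}. \<sigma> j < \<sigma> (Suc i))"
      by (auto simp: Ball_def) (metis Suc_le_D Suc_less_eq)
    then show ?thesis using that pos[of "Suc i"] by (simp add: is_record_def)
  qed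
  \<comment> \<open>A record exceeds its left neighbour, where \<open>\<sigma> 0 = 0\<close> settles
    the first position; and \<open>\<sigma> (n + 1) = n + 1\<close> makes the last position an
    ascent. So foremaxima are the records that are not descents.\<close>
  have fmax: "(is_double_ascent n \<sigma> i \<and> is_record n \<sigma> i) = (\<not> is_descent n \<sigma> i \<and> is_record n \<sigma> i)"
    if i: "i \<in> {1..n}" for i
  proof -
    have "\<sigma> (i - 1) < \<sigma> i" if "is_record n \<sigma> i"
      using that pos[OF i] zero i by (cases "i = 1") (auto simp: is_record_def)
    moreover have "\<not> is_descent n \<sigma> i \<longleftrightarrow> \<sigma> i < \<sigma> (i + 1)"
    proof (cases "i = n")
      case True
      then show ?thesis using permutes_in_image[OF s, of n] i last by (simp add: is_descent_def)
    next
      case False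
      have "\<sigma> i \<noteq> \<sigma> (i + 1)" using permutes_inj[OF s] by (simp add: inj_eq)
      then show ?thesis using False i by (auto simp: is_descent_def)
    qed
    ultimately show ?thesis using i by (auto simp: is_double_ascent_def)
  qed
  have fm: "w ^ fmax n \<sigma> = (\<Prod>i\<in>{1..n}. if \<not> is_descent n \<sigma> i \<and> is_record n \<sigma> i then w else 1)"
    unfolding fmax_def by (subst power_card_filter) (auto simp: fmax intro!: prod.cong)
  have "word_wt w (lam * t) 1 t 0 (map \<sigma> [1..<Suc n]) = (\<Prod>i<n.
     if is_record n \<sigma> (Suc i) then (if is_descent n \<sigma> (Suc i) then lam * t else w)
     else (if is_descent n \<sigma> (Suc i) then t else 1))"
    unfolding word_wt_eq_prod
    by (rule prod.cong) (auto simp: rec[symmetric] is_descent_def simp del: upt_Suc)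
  also have "\<dots> = (\<Prod>i\<in>{1..n}. if is_record n \<sigma> i then (if is_descent n \<sigma> i then lam * t else w)
     else (if is_descent n \<sigma> i then t else 1))"
    by (simp add: prod.atLeast1_atMost_eq)
  also have "\<dots> = t ^ des n \<sigma> * lam ^ des2 n \<sigma> * w ^ fmax n \<sigma>"
    unfolding des des2 fm prod.distrib[symmetric] by (rule prod.cong) auto
  finally show ?thesis .
qed

lemma B_eq_sum_des:
  fixes t lam w :: "'a::field_char_0"
  shows "B n t lam w = (\<Sum>\<sigma> | \<sigma> permutes {1..n}. t ^ des n \<sigma> * lam ^ des2 n \<sigma> * w ^ fmax n \<sigma>)"
proof -
  have "B n t lam w
      = (\<Sum>\<sigma> | \<sigma> permutes {1..n}. word_wt w (lam * t) 1 t 0 (map \<sigma> [1..<Suc n]))"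
    unfolding B_eq_sum_words by (rule sum.reindex_bij_betw[OF bij_betw_permutes_words, symmetric])
  also have "\<dots> = (\<Sum>\<sigma> | \<sigma> permutes {1..n}. t ^ des n \<sigma> * lam ^ des2 n \<sigma> * w ^ fmax n \<sigma>)"
    by (intro sum.cong refl word_wt_permutes) simp
  finally show ?thesis .
qed

section \<open>Growing partial injections\<close>

text \<open>Partial injections are encoded as sets of cells, with at most one in each row and
  column, so that restriction to a smaller square is an intersection.\<close>

definition rooks :: "nat \<Rightarrow> (nat \<times> nat) set set" where
  "rooks n = {R. R \<subseteq> {1..n} \<times> {1..n} \<and> single_valued R \<and> single_valued (R\<inverse>)}"

abbreviation corner :: "nat \<Rightarrow> (nat \<times> nat) set \<Rightarrow> (nat \<times> nat) set" where
  "corner n R \<equiv> R \<inter> {1..n} \<times> {1..n}"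

lemma rooks_0: "rooks 0 = {{}}"
  by (auto simp: rooks_def)

lemma finite_rooks: "finite (rooks n)"
  by (rule finite_subset[of _ "Pow ({1..n} \<times> {1..n})"]) (auto simp: rooks_def)

lemma rooks_finite: "R \<in> rooks n \<Longrightarrow> finite R"
  by (auto simp: rooks_def intro: finite_subset)

lemma corner_rooks: "R \<in> rooks m \<Longrightarrow> corner n R \<in> rooks n"
  by (auto simp: rooks_def single_valued_def)

lemma card_Domain_rooks: "R \<in> rooks n \<Longrightarrow> card (Domain R) = card R"
  unfolding Domain_fst by (rule card_image) (auto simp: rooks_def inj_on_def single_valued_def)

lemma card_Range_rooks: "R \<in> rooks n \<Longrightarrow> card (Range R) = card R"
  unfolding Range_snd by (rule card_image) (auto simp: rooks_def inj_on_def single_valued_def)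

lemma card_free_rows: "R \<in> rooks n \<Longrightarrow> card ({1..n} - Domain R) = n - card R"
  by (subst card_Diff_subset) (auto simp: card_Domain_rooks rooks_finite finite_Domain, auto simp: rooks_def)

lemma card_free_cols: "R \<in> rooks n \<Longrightarrow> card ({1..n} - Range R) = n - card R"
  by (subst card_Diff_subset) (auto simp: card_Range_rooks rooks_finite finite_Range, auto simp: rooks_def)

lemma card_rooks_le: "R \<in> rooks n \<Longrightarrow> card R \<le> n"
  using card_mono[of "{1..n}" "Domain R"] card_Domain_rooks[of R n] by (fastforce simp: rooks_def)

text \<open>The cases tell which cells lie in the new row and column: none (up step), the diagonal
  cell, a cell over a free row \<open>p\<close>, a cell over a free column \<open>v\<close> (three
  kinds of level step), or one of each of the last two (down step).\<close>

lemma corner_extensions: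
  assumes R: "R \<in> rooks n"
  defines "P \<equiv> {1..n} - Domain R" and "V \<equiv> {1..n} - Range R"
  shows "{R' \<in> rooks (Suc n). corner n R' = R} =
    {R} \<union> {insert (Suc n, Suc n) R} \<union> (\<lambda>p. insert (p, Suc n) R) ` P
      \<union> (\<lambda>v. insert (Suc n, v) R) ` V
      \<union> (\<lambda>(p, v). insert (p, Suc n) (insert (Suc n, v) R)) ` (P \<times> V)" (is "?L = ?E")
proof (intro set_eqI iffI)
  fix R' assume "R' \<in> ?L"
  then have sub: "R' \<subseteq> {1..Suc n} \<times> {1..Suc n}" and sv: "single_valued R'" "single_valued (R'\<inverse>)"
    and cor: "corner n R' = R" by (auto simp: rooks_def)
  have row: "j = j'" if "(i, j) \<in> R'" "(i, j') \<in> R'" for i j j'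
    using sv that by (auto simp: single_valued_def)
  have col: "i = i'" if "(i, j) \<in> R'" "(i', j) \<in> R'" for i i' j
    using sv that by (auto simp: single_valued_def)
  have mem: "(i, j) \<in> R \<or> i = Suc n \<or> j = Suc n" if "(i, j) \<in> R'" for i j
    using that sub unfolding cor[symmetric] by auto
  have RR: "R \<subseteq> R'" "R \<subseteq> {1..n} \<times> {1..n}" using cor by auto
  have P: "p \<in> P" if "(p, Suc n) \<in> R'" "p \<noteq> Suc n" for p
  proof -
    have "p \<notin> Domain R" using row[OF that(1)] RR by (fastforce simp: Domain_iff)
    then show ?thesis using that sub unfolding P_def by auto
  qed
  have V: "v \<in> V" if "(Suc n, v) \<in> R'" "v \<noteq> Suc n" for v
  proof -
    have "v \<notin> Range R" using col[OF that(1)] RR by (fastforce simp: Range_iff)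
    then show ?thesis using that sub unfolding V_def by auto
  qed
  consider "(Suc n, Suc n) \<in> R'"
    | p v where "(p, Suc n) \<in> R'" "(Suc n, v) \<in> R'" "p \<noteq> Suc n" "v \<noteq> Suc n"
    | p where "(p, Suc n) \<in> R'" "p \<noteq> Suc n" "\<forall>v. (Suc n, v) \<notin> R'"
    | v where "(Suc n, v) \<in> R'" "v \<noteq> Suc n" "\<forall>p. (p, Suc n) \<notin> R'"
    | "\<forall>v. (Suc n, v) \<notin> R'" "\<forall>p. (p, Suc n) \<notin> R'"
    by metis
  then show "R' \<in> ?E"
  proof cases
    case 1
    then have "R' = insert (Suc n, Suc n) R" using mem row col RR by (intro equalityI subrelI) blast+
    then show ?thesis by auto
  next
    case (2 p v)
    then have "R' = insert (p, Suc n) (insert (Suc n, v) R)" using mem row col RR by (intro equalityI subrelI) blast+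
    then show ?thesis using P[of p] V[of v] 2 by auto
  next
    case (3 p)
    then have "R' = insert (p, Suc n) R" using mem row col RR by (intro equalityI subrelI) blast+
    then show ?thesis using P[of p] 3 by auto
  next
    case (4 v)
    then have "R' = insert (Suc n, v) R" using mem row col RR by (intro equalityI subrelI) blast+
    then show ?thesis using V[of v] 4 by auto
  next
    case 5
    then have "R' = R" using mem RR by (intro equalityI subrelI) blast+
    then show ?thesis by auto
  qed
next
  fix R' assume "R' \<in> ?E"
  then consider "R' = R" | "R' = insert (Suc n, Suc n) R"
    | p where "p \<in> P" "R' = insert (p, Suc n) R"
    | v where "v \<in> V" "R' = insert (Suc n, v) R"
    | p v where "p \<in> P" "v \<in> V" "R' = insert (p, Suc n) (insert (Suc n, v) R)"
    by auto
  moreover have "R \<subseteq> {1..n} \<times> {1..n}" "single_valued R" "single_valued (R\<inverse>)"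
    using R by (auto simp: rooks_def)
  moreover from this(1) have "(Suc n, j) \<notin> R" "(i, Suc n) \<notin> R" for i j by auto
  ultimately show "R' \<in> ?L"
    by cases (auto simp: rooks_def P_def V_def single_valued_def)
qed

text \<open>\<open>sp n R p v\<close> marks the free column \<open>v\<close> for the free row
  \<open>p\<close>; the locale knows only that each row has one marked column. The weights
  \<open>te\<close> and \<open>td\<close> of the two sides of the diagonal are kept apart because
  the reversal used for \<open>pex\<close> exchanges these sides.\<close>

locale rook_weights =
  fixes te td lam w :: "'a::comm_ring_1"
    and sp :: "nat \<Rightarrow> (nat \<times> nat) set \<Rightarrow> nat \<Rightarrow> nat \<Rightarrow> bool"
  assumes sp_unique: "\<lbrakk>R \<in> rooks n; p \<in> {1..n} - Domain R\<rbrakk>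
    \<Longrightarrow> \<exists>!v. v \<in> {1..n} - Range R \<and> sp n R p v"
begin

text \<open>The pair that is closed at the cycle peak \<open>Suc m\<close> is marked by \<open>sp\<close>.\<close>

definition special :: "nat \<Rightarrow> (nat \<times> nat) set \<Rightarrow> bool" where
  "special m R \<longleftrightarrow> (\<exists>p v. p \<le> m \<and> v \<le> m \<and> (p, Suc m) \<in> R \<and> (Suc m, v) \<in> R \<and> sp m (corner m R) p v)"

definition cell_wt :: "nat \<times> nat \<Rightarrow> 'a" where
  "cell_wt c = (if fst c < snd c then te else if fst c = snd c then w else td)"

definition wt :: "nat \<Rightarrow> (nat \<times> nat) set \<Rightarrow> 'a" where
  "wt n R = (\<Prod>c\<in>R. cell_wt c) * (\<Prod>m<n. if special m R then lam else 1)"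

definition g :: "nat \<Rightarrow> 'a" where "g k = w + of_nat k * (te + td)"
definition b :: "nat \<Rightarrow> 'a" where "b k = of_nat k * (te * td) * (lam + of_nat k - 1)"

text \<open>\<open>special m\<close> inspects only the square of side \<open>m + 1\<close>, so later
  growth does not alter a mark. This makes \<open>wt\<close> multiplicative along the
  growth.\<close>

lemma special_corner:
  assumes "m < n" "R \<subseteq> {1..} \<times> {1..}"
  shows "special m (corner n R) = special m R"
proof -
  have c: "corner m (corner n R) = corner m R" using assms by auto
  have "(p, Suc m) \<in> corner n R \<longleftrightarrow> (p, Suc m) \<in> R" "(Suc m, v) \<in> corner n R \<longleftrightarrow> (Suc m, v) \<in> R"
    if "p \<le> m" "v \<le> m" for p v
    using assms that by auto
  then show ?thesis unfolding special_def c by blast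
qed

lemma wt_Suc:
  assumes "R' \<in> rooks (Suc n)" "corner n R' = R" "R' = R \<union> D" "R \<inter> D = {}"
  shows "wt (Suc n) R' = wt n R * ((\<Prod>c\<in>D. cell_wt c) * (if special n R' then lam else 1))"
proof -
  have "special m R' = special m R" if "m < n" for m
  proof -
    have "special m (corner n R') = special m R'"
      using assms(1) by (intro special_corner that) (auto simp: rooks_def)
    then show ?thesis unfolding assms(2) by simp
  qed
  then have "(\<Prod>m<n. if special m R' then lam else 1) = (\<Prod>m<n. if special m R then lam else 1)"
    by (intro prod.cong) auto
  moreover have "(\<Prod>c\<in>R'. cell_wt c) = (\<Prod>c\<in>R. cell_wt c) * (\<Prod>c\<in>D. cell_wt c)"
    using rooks_finite[OF assms(1)] assms(3,4) by (simp add: prod.union_disjoint)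
  ultimately show ?thesis unfolding wt_def by (simp add: mult_ac)
qed

text \<open>By \<open>sp_unique\<close>, one of the \<open>n - card R\<close> free columns
  contributes \<open>lam\<close> and every other one contributes 1. This is the source of the factor
  \<open>lam + k - 1\<close> in \<open>b k\<close>.\<close>

lemma sum_special:
  assumes "R \<in> rooks n" "p \<in> {1..n} - Domain R"
  shows "(\<Sum>v\<in>{1..n} - Range R. if sp n R p v then lam else 1) = lam + of_nat (n - card R) - 1"
proof -
  define V where "V = {1..n} - Range R"
  obtain v0 where v0: "v0 \<in> V" "sp n R p v0" "\<And>v. v \<in> V \<Longrightarrow> sp n R p v \<Longrightarrow> v = v0"
    using sp_unique[OF assms] unfolding V_def by blast
  have fin: "finite V" by (simp add: V_def)
  have "(\<Sum>v\<in>V. if sp n R p v then lam else 1) = lam + (\<Sum>v\<in>V - {v0}. if sp n R p v then lam else 1)"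
    using v0(1,2) fin by (subst sum.remove[of _ v0]) auto
  also have "(\<Sum>v\<in>V - {v0}. if sp n R p v then lam else 1) = (\<Sum>v\<in>V - {v0}. 1)"
  proof (rule sum.cong[OF refl])
    fix v assume "v \<in> V - {v0}"
    then have "\<not> sp n R p v" using v0(3)[of v] by blast
    then show "(if sp n R p v then lam else 1) = 1" by simp
  qed
  also have "\<dots> = of_nat (card V) - 1"
  proof -
    have "card V = Suc (card (V - {v0}))" using v0(1) fin by (rule card.remove[rotated])
    then show ?thesis by simp
  qed
  finally show ?thesis using card_free_cols[OF assms(1)] by (simp add: V_def)
qed

text \<open>One path step from level \<open>k\<close>: the unchanged placement goes up, the diagonal
  cell together with \<open>k\<close> rows and \<open>k\<close> columns gives \<open>g k\<close>,
  and the \<open>k\<close> rows paired with columns give \<open>b k\<close> by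
  \<open>sum_special\<close>.\<close>

lemma sum_extensions:
  assumes R: "R \<in> rooks n"
  defines "k \<equiv> n - card R"
  shows "(\<Sum>R' | R' \<in> rooks (Suc n) \<and> corner n R' = R. wt (Suc n) R' * f (Suc n - card R'))
    = wt n R * (f (Suc k) + g k * f k + b k * f (k - 1))"
proof -
  let ?N = "Suc n"
  define P V where "P = {1..n} - Domain R" and "V = {1..n} - Range R"
  define h where "h R' = wt ?N R' * f (?N - card R')" for R'
  define E where "E = {R' \<in> rooks (Suc n). corner n R' = R}"
  note E = corner_extensions[OF R, folded P_def V_def, folded E_def]
  have fin: "finite R" "finite P" "finite V" using R by (auto simp: rooks_finite P_def V_def)
  have sub: "R \<subseteq> {1..n} \<times> {1..n}" using R by (auto simp: rooks_def)
  have N: "(?N, j) \<notin> R" "(i, ?N) \<notin> R" for i j using sub by auto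
  have PV: "\<And>p. p \<in> P \<Longrightarrow> p \<noteq> ?N \<and> p < ?N" "\<And>v. v \<in> V \<Longrightarrow> v \<noteq> ?N \<and> v < ?N"
    by (auto simp: P_def V_def)
  have card: "card P = k" "card V = k"
    using card_free_rows[OF R] card_free_cols[OF R] by (auto simp: P_def V_def k_def)
  have kn: "?N - card R = Suc k" using card_rooks_le[OF R] by (simp add: k_def)
  have kn': "n - card R = k" "n - Suc (card R) = k - 1" by (simp_all add: k_def)
  have cor: "R' \<in> rooks ?N \<and> corner n R' = R" if "R' \<in> E" for R'
    using that by (simp add: E_def)
  have wtE: "wt ?N R' = wt n R * ((\<Prod>c\<in>D. cell_wt c) * (if special n R' then lam else 1))"
    if "R' \<in> E" "R' = R \<union> D" "R \<inter> D = {}" for R' D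
    using cor[OF that(1)] that(2,3) by (intro wt_Suc) simp_all
  have spE: "special n R' \<longleftrightarrow> (\<exists>p v. p \<le> n \<and> v \<le> n \<and> (p, ?N) \<in> R' \<and> (?N, v) \<in> R' \<and> sp n R p v)"
    if "R' \<in> E" for R' using cor[OF that] by (simp add: special_def)
  have h1: "h R = wt n R * f (Suc k)"
  proof -
    have "R \<in> E" by (simp add: E)
    then show ?thesis using wtE[of R "{}"] spE[of R] N by (simp add: h_def kn)
  qed
  have h2: "h (insert (?N, ?N) R) = wt n R * (w * f k)"
  proof -
    have e: "insert (?N, ?N) R \<in> E" by (simp add: E)
    have "\<not> special n (insert (?N, ?N) R)" using spE[OF e] N by auto
    then show ?thesis using wtE[OF e, of "{(?N, ?N)}"] N fin kn
      by (simp add: h_def cell_wt_def kn' mult_ac)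
  qed
  have h3: "h (insert (p, ?N) R) = wt n R * (te * f k)" if p: "p \<in> P" for p
  proof -
    have e: "insert (p, ?N) R \<in> E" using p by (simp add: E)
    have "\<not> special n (insert (p, ?N) R)" using spE[OF e] N PV(1)[OF p] by auto
    then show ?thesis using wtE[OF e, of "{(p, ?N)}"] N fin kn PV(1)[OF p]
      by (simp add: h_def cell_wt_def kn' mult_ac)
  qed
  have h4: "h (insert (?N, v) R) = wt n R * (td * f k)" if v: "v \<in> V" for v
  proof -
    have e: "insert (?N, v) R \<in> E" using v by (simp add: E)
    have "\<not> special n (insert (?N, v) R)" using spE[OF e] N PV(2)[OF v] by auto
    then show ?thesis using wtE[OF e, of "{(?N, v)}"] N fin kn PV(2)[OF v]
      by (simp add: h_def cell_wt_def kn' mult_ac)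
  qed
  have h5: "h (insert (p, ?N) (insert (?N, v) R))
      = wt n R * (te * td * f (k - 1)) * (if sp n R p v then lam else 1)" if p: "p \<in> P" and v: "v \<in> V" for p v
  proof -
    have e: "insert (p, ?N) (insert (?N, v) R) \<in> E" using p v by (auto simp: E)
    have "special n (insert (p, ?N) (insert (?N, v) R)) \<longleftrightarrow> sp n R p v"
      unfolding spE[OF e] using N PV(1)[OF p] PV(2)[OF v] by auto
    then show ?thesis using wtE[OF e, of "{(p, ?N), (?N, v)}"] N fin kn PV(1)[OF p] PV(2)[OF v]
      by (simp add: h_def cell_wt_def kn' mult_ac)
  qed
  have inj3: "inj_on (\<lambda>p. insert (p, ?N) R) P"
    using N by (intro inj_onI) (metis Pair_inject insertE insertI1)
  have inj4: "inj_on (\<lambda>v. insert (?N, v) R) V"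
    using N by (intro inj_onI) (metis Pair_inject insertE insertI1)
  have inj5: "inj_on (\<lambda>(p, v). insert (p, ?N) (insert (?N, v) R)) (P \<times> V)"
  proof (rule inj_onI, clarify)
    fix p v p' v'
    assume *: "p \<in> P" "v \<in> V" "p' \<in> P" "v' \<in> V"
      "insert (p, ?N) (insert (?N, v) R) = insert (p', ?N) (insert (?N, v') R)"
    then have "(p, ?N) \<in> insert (p', ?N) (insert (?N, v') R)"
      "(?N, v) \<in> insert (p', ?N) (insert (?N, v') R)" by blast+
    then show "p = p' \<and> v = v'" using N PV * by blast
  qed
  let ?A3 = "(\<lambda>p. insert (p, ?N) R) ` P" and ?A4 = "(\<lambda>v. insert (?N, v) R) ` V"
    and ?A5 = "(\<lambda>(p, v). insert (p, ?N) (insert (?N, v) R)) ` (P \<times> V)"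
  \<comment> \<open>\<open>lab\<close> records which of the three sorts of new cell occur. Its
    values differ on the five families of extensions, which proves them disjoint.\<close>
  define lab where "lab X = (\<exists>v\<in>V. (?N, v) \<in> X, \<exists>p\<in>P. (p, ?N) \<in> X, (?N, ?N) \<in> X)" for X
  have NPV: "?N \<notin> P" "?N \<notin> V" using PV by blast+
  have l1: "lab R = (False, False, False)" using N by (simp add: lab_def)
  have l2: "lab (insert (?N, ?N) R) = (False, False, True)" using N NPV by (auto simp: lab_def)
  have l3: "lab X = (False, True, False)" if "X \<in> ?A3" for X using that N NPV by (auto simp: lab_def)
  have l4: "lab X = (True, False, False)" if "X \<in> ?A4" for X using that N NPV by (auto simp: lab_def)
  have l5: "lab X = (True, True, False)" if "X \<in> ?A5" for X using that N NPV by (auto simp: lab_def)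
  have disj: "A \<inter> C = {}" if "\<And>X. X \<in> A \<Longrightarrow> lab X \<noteq> x" "\<And>X. X \<in> C \<Longrightarrow> lab X = x" for A C x
    using that by blast
  have d1: "{R} \<inter> {insert (?N, ?N) R} = {}"
    by (rule disj[where x = "(False, False, True)"]) (auto simp: l1 l2)
  have d2: "({R} \<union> {insert (?N, ?N) R}) \<inter> ?A3 = {}"
    by (rule disj[OF _ l3]) (auto simp: l1 l2)
  have d3: "({R} \<union> {insert (?N, ?N) R} \<union> ?A3) \<inter> ?A4 = {}"
    by (rule disj[OF _ l4], elim UnE) (simp_all add: l1 l2 l3)
  have d4: "({R} \<union> {insert (?N, ?N) R} \<union> ?A3 \<union> ?A4) \<inter> ?A5 = {}"
    by (rule disj[OF _ l5], elim UnE) (simp_all add: l1 l2 l3 l4)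
  have "sum h E = h R + h (insert (?N, ?N) R) + sum h ?A3 + sum h ?A4 + sum h ?A5"
    unfolding E
    by (subst sum.union_disjoint[OF _ _ d4], use fin in simp, use fin in simp,
        subst sum.union_disjoint[OF _ _ d3], use fin in simp, use fin in simp,
        subst sum.union_disjoint[OF _ _ d2], use fin in simp, use fin in simp,
        subst sum.union_disjoint[OF _ _ d1]) simp_all
  also have "sum h ?A3 = wt n R * (of_nat k * (te * f k))"
    by (subst sum.reindex[OF inj3]) (simp add: h3 card mult_ac)
  also have "sum h ?A4 = wt n R * (of_nat k * (td * f k))"
    by (subst sum.reindex[OF inj4]) (simp add: h4 card mult_ac)
  also have "sum h ?A5 = (\<Sum>p\<in>P. \<Sum>v\<in>V. wt n R * (te * td * f (k - 1)) * (if sp n R p v then lam else 1))"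
    unfolding sum.reindex[OF inj5] sum.cartesian_product by (rule sum.cong) (auto simp: h5)
  also have "\<dots> = (\<Sum>p\<in>P. wt n R * (te * td * f (k - 1)) * (lam + of_nat k - 1))"
    by (rule sum.cong[OF refl])
      (use sum_special[OF R] in \<open>simp only: sum_distrib_left[symmetric] P_def V_def k_def\<close>)
  also have "\<dots> = wt n R * (b k * f (k - 1))" by (simp add: card b_def mult_ac)
  finally have "sum h E = wt n R * (f (Suc k) + g k * f k + b k * f (k - 1))"
    by (simp add: h1 h2 g_def algebra_simps)
  then show ?thesis by (simp add: h_def E_def)
qed

text \<open>The first \<open>n\<close> steps are realised by placements and the last
  \<open>m\<close> remain abstract paths; enlarging the square turns one abstract step into a
  concrete one.\<close>

lemma sum_rooks_path_weight:
  "(\<Sum>R\<in>rooks n. wt n R * path_weight g b m (n - card R)) = path_weight g b (n + m) 0"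
proof (induction n arbitrary: m)
  case 0
  then show ?case by (simp add: rooks_0 wt_def)
next
  case (Suc n)
  have "(\<Sum>R\<in>rooks (Suc n). wt (Suc n) R * path_weight g b m (Suc n - card R))
     = (\<Sum>R\<in>rooks n. \<Sum>R' | R' \<in> rooks (Suc n) \<and> corner n R' = R.
          wt (Suc n) R' * path_weight g b m (Suc n - card R'))"
    by (rule sum.group[symmetric]) (use corner_rooks finite_rooks in blast)+
  also have "\<dots> = (\<Sum>R\<in>rooks n. wt n R * path_weight g b (Suc m) (n - card R))"
    \<comment> \<open>At level 0 the truncated \<open>k - 1\<close> in \<open>sum_extensions\<close>
      does no harm, since \<open>b 0 = 0\<close>.\<close>
    by (rule sum.cong[OF refl], subst sum_extensions) (simp_all add: b_def)
  finally show ?case using Suc.IH[of "Suc m"] by simp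
qed

end

section \<open>Permutations as placements without free rows\<close>

definition graph :: "nat \<Rightarrow> (nat \<Rightarrow> nat) \<Rightarrow> (nat \<times> nat) set" where
  "graph n \<sigma> = (\<lambda>i. (i, \<sigma> i)) ` {1..n}"

lemma in_graph: "(i, j) \<in> graph n \<sigma> \<longleftrightarrow> i \<in> {1..n} \<and> j = \<sigma> i"
  by (auto simp: graph_def)

lemma card_graph: "card (graph n \<sigma>) = n"
  unfolding graph_def by (subst card_image) (auto simp: inj_on_def)

text \<open>A placement with \<open>n\<close> rooks leaves no row free, hence is the graph of a
  function on \<open>{1..n}\<close>; injectivity by columns and finiteness make it a
  permutation.\<close>

lemma bij_betw_graph:
  "bij_betw (graph n) {\<sigma>. \<sigma> permutes {1..n}} {R \<in> rooks n. card R = n}"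
proof (rule bij_betw_imageI)
  show "inj_on (graph n) {\<sigma>. \<sigma> permutes {1..n}}"
  proof (rule inj_onI, rule ext)
    fix \<sigma> \<tau> i assume *: "\<sigma> \<in> {\<sigma>. \<sigma> permutes {1..n}}" "\<tau> \<in> {\<sigma>. \<sigma> permutes {1..n}}" "graph n \<sigma> = graph n \<tau>"
    show "\<sigma> i = \<tau> i"
    proof (cases "i \<in> {1..n}")
      case True
      then show ?thesis using *(3) in_graph by metis
    next
      case False
      then show ?thesis using * by (simp add: permutes_not_in)
    qed
  qed
  show "graph n ` {\<sigma>. \<sigma> permutes {1..n}} = {R \<in> rooks n. card R = n}"
  proof (intro set_eqI iffI)
    fix R assume "R \<in> graph n ` {\<sigma>. \<sigma> permutes {1..n}}"
    then obtain \<sigma> where s: "\<sigma> permutes {1..n}" and R: "R = graph n \<sigma>" by auto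
    have "R \<in> rooks n"
      using permutes_image[OF s] injD[OF permutes_inj[OF s]]
      unfolding R rooks_def by (fastforce simp: in_graph single_valued_def)
    then show "R \<in> {R \<in> rooks n. card R = n}" by (simp add: R card_graph)
  next
    fix R assume "R \<in> {R \<in> rooks n. card R = n}"
    then have R: "R \<in> rooks n" and c: "card R = n" by auto
    then have sub: "R \<subseteq> {1..n} \<times> {1..n}" and sv: "single_valued R" "single_valued (R\<inverse>)"
      by (auto simp: rooks_def)
    have "{1..n} - Domain R = {}" using card_free_rows[OF R] c by simp
    then have "\<forall>i\<in>{1..n}. \<exists>j. (i, j) \<in> R" by auto
    then obtain f where f: "\<And>i. i \<in> {1..n} \<Longrightarrow> (i, f i) \<in> R" by metis
    define \<sigma> where "\<sigma> i = (if i \<in> {1..n} then f i else i)" for i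
    have "inj_on \<sigma> {1..n}"
    proof (rule inj_onI)
      fix i i' assume *: "i \<in> {1..n}" "i' \<in> {1..n}" "\<sigma> i = \<sigma> i'"
      then have "(f i, i) \<in> R\<inverse>" "(f i, i') \<in> R\<inverse>" using f[of i] f[of i'] by (auto simp: \<sigma>_def)
      then show "i = i'" by (rule single_valuedD[OF sv(2)])
    qed
    moreover have "\<sigma> ` {1..n} \<subseteq> {1..n}"
    proof (rule image_subsetI)
      fix i assume i: "i \<in> {1..n}"
      then have "(i, f i) \<in> {1..n} \<times> {1..n}" using f[of i] sub by blast
      then show "\<sigma> i \<in> {1..n}" using i by (simp add: \<sigma>_def)
    qed
    ultimately have "bij_betw \<sigma> {1..n} {1..n}"
      by (simp add: bij_betw_def endo_inj_surj)
    then have s: "\<sigma> permutes {1..n}" by (rule bij_imp_permutes) (auto simp: \<sigma>_def)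
    have "R = graph n \<sigma>"
    proof (intro set_eqI iffI; clarify)
      fix i j assume "(i, j) \<in> R"
      then have "i \<in> {1..n}" "j = f i" using f[of i] sub single_valuedD[OF sv(1)] by auto
      then show "(i, j) \<in> graph n \<sigma>" by (simp add: in_graph \<sigma>_def)
    next
      fix i j assume "(i, j) \<in> graph n \<sigma>"
      then show "(i, j) \<in> R" using f[of i] by (auto simp: in_graph \<sigma>_def)
    qed
    then show "R \<in> graph n ` {\<sigma>. \<sigma> permutes {1..n}}" using s by blast
  qed
qed

text \<open>This is \<open>special\<close> for the graph of \<open>\<sigma>\<close>, with the index
  \<open>m\<close> shifted to the cycle peak \<open>i = m + 1\<close>.\<close>

definition special_at ::
  "(nat \<Rightarrow> (nat \<times> nat) set \<Rightarrow> nat \<Rightarrow> nat \<Rightarrow> bool) \<Rightarrow> nat \<Rightarrow> (nat \<Rightarrow> nat) \<Rightarrow> nat \<Rightarrow> bool" where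
  "special_at sp n \<sigma> i \<longleftrightarrow>
     inv \<sigma> i < i \<and> \<sigma> i < i \<and> sp (i - 1) (corner (i - 1) (graph n \<sigma>)) (inv \<sigma> i) (\<sigma> i)"

context rook_weights
begin

lemma special_graph:
  assumes s: "\<sigma> permutes {1..n}" and m: "m < n"
  shows "special m (graph n \<sigma>) \<longleftrightarrow> special_at sp n \<sigma> (Suc m)"
proof -
  have "(p, Suc m) \<in> graph n \<sigma> \<longleftrightarrow> p = inv \<sigma> (Suc m)" for p
  proof -
    have "\<sigma> p = Suc m \<longleftrightarrow> p = inv \<sigma> (Suc m)" using permutes_inv_eq[OF s] by metis
    moreover have "\<sigma> p = Suc m \<Longrightarrow> p \<in> {1..n}" using permutes_in_image[OF s, of p] m by simp
    ultimately show ?thesis unfolding in_graph by auto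
  qed
  moreover have "(Suc m, v) \<in> graph n \<sigma> \<longleftrightarrow> v = \<sigma> (Suc m)" for v using m by (auto simp: in_graph)
  ultimately show ?thesis by (auto simp: special_def special_at_def less_Suc_eq_le)
qed

lemma sum_permutes_path_weight:
  "(\<Sum>\<sigma> | \<sigma> permutes {1..n}. te ^ card {i \<in> {1..n}. i < \<sigma> i} * td ^ card {i \<in> {1..n}. \<sigma> i < i}
      * lam ^ card {i \<in> {1..n}. special_at sp n \<sigma> i} * w ^ fixpts n \<sigma>) = path_weight g b n 0"
proof -
  have wt: "wt n (graph n \<sigma>) = te ^ card {i \<in> {1..n}. i < \<sigma> i} * td ^ card {i \<in> {1..n}. \<sigma> i < i}
      * lam ^ card {i \<in> {1..n}. special_at sp n \<sigma> i} * w ^ fixpts n \<sigma>" if s: "\<sigma> permutes {1..n}" for \<sigma>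
  proof -
    have "(\<Prod>c\<in>graph n \<sigma>. cell_wt c) = (\<Prod>i\<in>{1..n}. cell_wt (i, \<sigma> i))"
      unfolding graph_def by (subst prod.reindex) (auto simp: inj_on_def)
    moreover have "(\<Prod>m<n. if special m (graph n \<sigma>) then lam else 1)
        = (\<Prod>i\<in>{1..n}. if special_at sp n \<sigma> i then lam else 1)"
      by (simp add: prod.atLeast1_atMost_eq special_graph[OF s])
    ultimately have "wt n (graph n \<sigma>)
        = (\<Prod>i\<in>{1..n}. cell_wt (i, \<sigma> i) * (if special_at sp n \<sigma> i then lam else 1))"
      by (simp add: wt_def prod.distrib)
    also have "\<dots> = te ^ card {i \<in> {1..n}. i < \<sigma> i} * td ^ card {i \<in> {1..n}. \<sigma> i < i}
      * lam ^ card {i \<in> {1..n}. special_at sp n \<sigma> i} * w ^ fixpts n \<sigma>"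
      unfolding fixpts_def power_card_filter[OF finite_atLeastAtMost] prod.distrib[symmetric]
      by (rule prod.cong) (auto simp: cell_wt_def)
    finally show ?thesis .
  qed
  have "path_weight g b n 0 = (\<Sum>R\<in>rooks n. wt n R * path_weight g b 0 (n - card R))"
    using sum_rooks_path_weight[of n 0] by simp
  \<comment> \<open>With no steps left, \<open>path_weight\<close> is 1 at level 0 and 0 elsewhere,
    so only the full placements survive.\<close>
  also have "\<dots> = (\<Sum>R\<in>{R \<in> rooks n. card R = n}. wt n R)"
    using finite_rooks card_rooks_le
    by (intro sum.mono_neutral_cong_right) (auto simp: le_antisym)
  also have "\<dots> = (\<Sum>\<sigma> | \<sigma> permutes {1..n}. wt n (graph n \<sigma>))"
    by (rule sum.reindex_bij_betw[OF bij_betw_graph, symmetric])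
  also have "\<dots> = (\<Sum>\<sigma> | \<sigma> permutes {1..n}. te ^ card {i \<in> {1..n}. i < \<sigma> i} * td ^ card {i \<in> {1..n}. \<sigma> i < i}
      * lam ^ card {i \<in> {1..n}. special_at sp n \<sigma> i} * w ^ fixpts n \<sigma>)"
    by (intro sum.cong refl wt) simp
  finally show ?thesis by simp
qed

end

section \<open>Statistics of cycle type\<close>

text \<open>\<open>g\<close> and \<open>b\<close> depend on \<open>te\<close> and \<open>td\<close>
  only through their sum and product, so both \<open>(t, 1)\<close> and \<open>(1, t)\<close> are
  admissible.\<close>

lemma B_eq_sum_special:
  fixes t lam w te td :: "'a::field_char_0"
  assumes "rook_weights sp" "te * td = t" "te + td = t + 1"
  shows "B n t lam w = (\<Sum>\<sigma> | \<sigma> permutes {1..n}.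
    te ^ card {i \<in> {1..n}. i < \<sigma> i} * td ^ card {i \<in> {1..n}. \<sigma> i < i}
      * lam ^ card {i \<in> {1..n}. special_at sp n \<sigma> i} * w ^ fixpts n \<sigma>)"
proof -
  interpret rook_weights te td lam w sp by fact
  have "g = jac_gamma t w" "b = jac_beta t lam"
    using assms(2,3) by (auto simp: fun_eq_iff g_def b_def)
  then show ?thesis using sum_permutes_path_weight[of n] by (simp add: B_eq_path_weight)
qed

text \<open>A value below \<open>i\<close> is free in the square of side \<open>i - 1\<close> when
  it is taken at position \<open>i\<close> or later. The bound is not strict, so
  \<open>\<sigma> i\<close> itself counts as free when \<open>\<sigma> i < i\<close>.\<close>

lemma free_col_iff:
  assumes s: "\<sigma> permutes {1..n}" and i: "i \<in> {1..n}"
  shows "u \<in> {1..i - 1} - Range (corner (i - 1) (graph n \<sigma>)) \<longleftrightarrow> 1 \<le> u \<and> u < i \<and> i \<le> inv \<sigma> u"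
proof (cases "1 \<le> u \<and> u < i")
  case True
  have "inv \<sigma> u \<in> {1..n}" using permutes_in_image[OF permutes_inv[OF s], of u] True i by simp
  moreover have "(j, u) \<in> graph n \<sigma> \<longleftrightarrow> j \<in> {1..n} \<and> j = inv \<sigma> u" for j
    unfolding in_graph using permutes_inv_eq[OF s] by metis
  ultimately have "u \<in> Range (corner (i - 1) (graph n \<sigma>)) \<longleftrightarrow> inv \<sigma> u < i"
    using True i unfolding Range_iff by auto
  then show ?thesis using True by auto
qed auto

lemma free_cols_nonempty:
  assumes "R \<in> rooks n" "p \<in> {1..n} - Domain R"
  shows "{1..n} - Range R \<noteq> {}"
proof -
  have "card ({1..n} - Domain R) \<noteq> 0" using assms(2) by (auto simp: card_eq_0_iff)
  then have "card ({1..n} - Range R) \<noteq> 0"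
    by (simp only: card_free_rows[OF assms(1)] card_free_cols[OF assms(1)] not_False_eq_True)
  then show ?thesis by (metis card.empty)
qed

section \<open>Three rules for marking a free column\<close>

definition least_free :: "nat \<Rightarrow> (nat \<times> nat) set \<Rightarrow> nat \<Rightarrow> nat \<Rightarrow> bool" where
  "least_free n R p v \<longleftrightarrow> (\<forall>u \<in> {1..n} - Range R. v \<le> u)"

definition greatest_free :: "nat \<Rightarrow> (nat \<times> nat) set \<Rightarrow> nat \<Rightarrow> nat \<Rightarrow> bool" where
  "greatest_free n R p v \<longleftrightarrow> (\<forall>u \<in> {1..n} - Range R. u \<le> v)"

text \<open>Read as arrows, the cells form disjoint paths and cycles. For a free row
  \<open>p\<close>, where a path ends, the free column \<open>v\<close> is the point where that path
  starts.\<close>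

definition same_path :: "nat \<Rightarrow> (nat \<times> nat) set \<Rightarrow> nat \<Rightarrow> nat \<Rightarrow> bool" where
  "same_path n R p v \<longleftrightarrow> (v, p) \<in> R\<^sup>*"

lemma rook_weights_least_free: "rook_weights least_free"
proof
  fix R n p assume *: "R \<in> rooks n" "p \<in> {1..n} - Domain R"
  define V where "V = {1..n} - Range R"
  have "finite V" "V \<noteq> {}" using free_cols_nonempty[OF *] by (auto simp: V_def)
  then have "\<exists>!v. v \<in> V \<and> (\<forall>u\<in>V. v \<le> u)"
    by (intro ex1I[of _ "Min V"]) (auto intro: Min_eqI[symmetric])
  then show "\<exists>!v. v \<in> {1..n} - Range R \<and> least_free n R p v"
    unfolding least_free_def V_def .
qed

lemma rook_weights_greatest_free: "rook_weights greatest_free"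
proof
  fix R n p assume *: "R \<in> rooks n" "p \<in> {1..n} - Domain R"
  define V where "V = {1..n} - Range R"
  have "finite V" "V \<noteq> {}" using free_cols_nonempty[OF *] by (auto simp: V_def)
  then have "\<exists>!v. v \<in> V \<and> (\<forall>u\<in>V. u \<le> v)"
    by (intro ex1I[of _ "Max V"]) (auto intro: Max_eqI[symmetric])
  then show "\<exists>!v. v \<in> {1..n} - Range R \<and> greatest_free n R p v"
    unfolding greatest_free_def V_def .
qed

text \<open>Existence: if every ancestor of \<open>p\<close> had a predecessor, choosing
  predecessors would give an injective, hence surjective, self-map of the finite set
  \<open>A\<close> of ancestors; then \<open>p\<close> would be a predecessor, but its row is free.
  Uniqueness: ancestors of \<open>p\<close> are comparable, and a free column has no
  predecessor.\<close>

lemma rook_weights_same_path: "rook_weights same_path"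
proof
  fix R n p assume R: "R \<in> rooks n" and p: "p \<in> {1..n} - Domain R"
  have sub: "R \<subseteq> {1..n} \<times> {1..n}" and sv: "single_valued R" "single_valued (R\<inverse>)"
    using R by (auto simp: rooks_def)
  define A where "A = {x. (x, p) \<in> R\<^sup>*}"
  have A: "A \<subseteq> insert p (Domain R)" unfolding A_def by (auto elim: converse_rtranclE)
  then have fin: "finite A" using rooks_finite[OF R] by (meson finite_Domain finite.insertI finite_subset)
  have "\<not> A \<subseteq> Range R"
  proof
    assume "A \<subseteq> Range R"
    then have "\<forall>x\<in>A. \<exists>y. (y, x) \<in> R" by blast
    then obtain h where h: "\<And>x. x \<in> A \<Longrightarrow> (h x, x) \<in> R" by metis
    have "h ` A \<subseteq> A"
    proof (rule image_subsetI)
      fix x assume "x \<in> A"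
      then show "h x \<in> A" using h[of x] unfolding A_def by (auto intro: converse_rtrancl_into_rtrancl)
    qed
    moreover have "inj_on h A"
    proof (rule inj_onI)
      fix x y assume *: "x \<in> A" "y \<in> A" "h x = h y"
      then have "(h x, x) \<in> R" "(h x, y) \<in> R" using h[of x] h[of y] by auto
      then show "x = y" by (rule single_valuedD[OF sv(1)])
    qed
    ultimately have "h ` A = A" using fin by (simp add: endo_inj_surj)
    moreover have "p \<in> A" by (simp add: A_def)
    ultimately obtain x where "x \<in> A" "p = h x" by blast
    then have "p \<in> Domain R" using h[of x] by auto
    then show False using p by blast
  qed
  then obtain v where v: "v \<in> A" "v \<notin> Range R" by blast
  show "\<exists>!v. v \<in> {1..n} - Range R \<and> same_path n R p v"
  proof (rule ex1I[of _ v])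
    have "v \<in> {1..n}" 
    proof -
      have "Domain R \<subseteq> {1..n}" using sub by auto
      then show ?thesis using v(1) A p by blast
    qed
    then show "v \<in> {1..n} - Range R \<and> same_path n R p v"
      using v by (simp add: same_path_def A_def)
  next
    fix u assume u: "u \<in> {1..n} - Range R \<and> same_path n R p u"
    have "(p, v) \<in> (R\<inverse>)\<^sup>*" "(p, u) \<in> (R\<inverse>)\<^sup>*"
      using u v(1) by (simp_all add: same_path_def A_def rtrancl_converse)
    then have "(v, u) \<in> (R\<inverse>)\<^sup>* \<or> (u, v) \<in> (R\<inverse>)\<^sup>*"
      by (rule single_valued_confluent[OF sv(2)])
    moreover have "x = v" if "(v, x) \<in> (R\<inverse>)\<^sup>*" for x
      using that v(2) by (auto elim: converse_rtranclE)
    moreover have "x = u" if "(u, x) \<in> (R\<inverse>)\<^sup>*" for x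
      using that u by (auto elim: converse_rtranclE)
    ultimately show "u = v" by blast
  qed
qed

text \<open>The free columns below \<open>i\<close> are the values less than \<open>i\<close> at
  positions from \<open>i\<close> on. As later values above \<open>i\<close> exceed
  \<open>\<sigma> i\<close> anyway, minimality means antirecord. A cycle peak is never a record,
  since the value \<open>i\<close> occurs earlier.\<close>

lemma special_at_least_free:
  assumes s: "\<sigma> permutes {1..n}" and i: "i \<in> {1..n}"
  shows "special_at least_free n \<sigma> i \<longleftrightarrow> is_exclusive_antirecord n \<sigma> i \<and> is_cycle_peak n \<sigma> i"
proof -
  have special: "special_at least_free n \<sigma> i \<longleftrightarrow>
      inv \<sigma> i < i \<and> \<sigma> i < i \<and> (\<forall>u. 1 \<le> u \<and> u < i \<and> i \<le> inv \<sigma> u \<longrightarrow> \<sigma> i \<le> u)"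
    unfolding special_at_def least_free_def Ball_def free_col_iff[OF s i] ..
  have inv: "\<sigma> (inv \<sigma> u) = u" "inv \<sigma> (\<sigma> u) = u" for u using permutes_inverses[OF s] by auto
  have range: "\<sigma> j \<in> {1..n}" "inv \<sigma> j \<in> {1..n}" if "j \<in> {1..n}" for j
    using that permutes_in_image[OF s] permutes_in_image[OF permutes_inv[OF s]] by auto
  show ?thesis
  proof
    assume "special_at least_free n \<sigma> i"
    then have sp: "inv \<sigma> i < i" "\<sigma> i < i" "\<And>u. \<lbrakk>1 \<le> u; u < i; i \<le> inv \<sigma> u\<rbrakk> \<Longrightarrow> \<sigma> i \<le> u"
      unfolding special by auto
    have "\<sigma> i < \<sigma> j" if j: "j \<in> {i<..n}" for j
    proof (cases "\<sigma> j < i")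
      case True
      then have "\<sigma> i \<le> \<sigma> j" using sp(3)[of "\<sigma> j"] inv(2)[of j] range(1)[of j] j by simp
      moreover have "\<sigma> i \<noteq> \<sigma> j" using inv(2) j by (metis greaterThanAtMost_iff less_irrefl)
      ultimately show ?thesis by simp
    next
      case False
      then show ?thesis using sp(2) by simp
    qed
    moreover have "\<not> is_record n \<sigma> i"
    proof
      assume "is_record n \<sigma> i"
      moreover have "inv \<sigma> i \<in> {1..<i}" using sp(1) range(2)[OF i] by simp
      ultimately have "\<sigma> (inv \<sigma> i) < \<sigma> i" by (simp add: is_record_def)
      then show False using sp(2) inv by simp
    qed
    ultimately show "is_exclusive_antirecord n \<sigma> i \<and> is_cycle_peak n \<sigma> i"
      using i sp by (simp add: is_exclusive_antirecord_def is_antirecord_def is_cycle_peak_def)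
  next
    assume a: "is_exclusive_antirecord n \<sigma> i \<and> is_cycle_peak n \<sigma> i"
    then have peak: "inv \<sigma> i < i" "\<sigma> i < i" and anti: "\<And>j. j \<in> {i<..n} \<Longrightarrow> \<sigma> i < \<sigma> j"
      by (auto simp: is_exclusive_antirecord_def is_antirecord_def is_cycle_peak_def)
    have "\<sigma> i \<le> u" if u: "1 \<le> u" "u < i" "i \<le> inv \<sigma> u" for u
    proof (cases "inv \<sigma> u = i")
      case True
      then show ?thesis using inv(1)[of u] by simp
    next
      case False
      then have "inv \<sigma> u \<in> {i<..n}" using u i range(2)[of u] by simp
      then show ?thesis using anti[of "inv \<sigma> u"] inv(1)[of u] by simp
    qed
    then show "special_at least_free n \<sigma> i" unfolding special using peak by blast
  qed
qed

lemma B_eq_sum_ear: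
  fixes t lam w :: "'a::field_char_0"
  shows "B n t lam w = (\<Sum>\<sigma> | \<sigma> permutes {1..n}. t ^ exc n \<sigma> * lam ^ ear n \<sigma> * w ^ fixpts n \<sigma>)"
proof -
  have "B n t lam w = (\<Sum>\<sigma> | \<sigma> permutes {1..n}.
    t ^ card {i \<in> {1..n}. i < \<sigma> i} * 1 ^ card {i \<in> {1..n}. \<sigma> i < i}
      * lam ^ card {i \<in> {1..n}. special_at least_free n \<sigma> i} * w ^ fixpts n \<sigma>)"
    by (rule B_eq_sum_special[OF rook_weights_least_free]) simp_all
  also have "\<dots> = (\<Sum>\<sigma> | \<sigma> permutes {1..n}. t ^ exc n \<sigma> * lam ^ ear n \<sigma> * w ^ fixpts n \<sigma>)"
  proof (rule sum.cong[OF refl])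
    fix \<sigma> assume "\<sigma> \<in> {\<sigma>. \<sigma> permutes {1..n}}"
    then have "{i \<in> {1..n}. special_at least_free n \<sigma> i}
        = {i \<in> {1..n}. is_exclusive_antirecord n \<sigma> i \<and> is_cycle_peak n \<sigma> i}"
      using special_at_least_free[of \<sigma> n] by blast
    then show "t ^ card {i \<in> {1..n}. i < \<sigma> i} * 1 ^ card {i \<in> {1..n}. \<sigma> i < i}
      * lam ^ card {i \<in> {1..n}. special_at least_free n \<sigma> i} * w ^ fixpts n \<sigma>
      = t ^ exc n \<sigma> * lam ^ ear n \<sigma> * w ^ fixpts n \<sigma>"
      by (simp only: exc_def ear_def power_one mult_1_right)
  qed
  finally show ?thesis .
qed

text \<open>Maximality excludes later values strictly between \<open>\<sigma> i\<close> and
  \<open>i\<close>. Excluding the endpoint \<open>i\<close> as well encodes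
  \<open>inv \<sigma> i < i\<close>. The result is the mirror image of the condition in
  \<open>pex\<close>.\<close>

lemma special_at_greatest_free:
  assumes s: "\<sigma> permutes {1..n}" and i: "i \<in> {1..n}"
  shows "special_at greatest_free n \<sigma> i \<longleftrightarrow> \<sigma> i < i \<and> (\<forall>j\<in>{i<..n}. \<sigma> j \<notin> {\<sigma> i..i})"
proof -
  have special: "special_at greatest_free n \<sigma> i \<longleftrightarrow>
      inv \<sigma> i < i \<and> \<sigma> i < i \<and> (\<forall>u. 1 \<le> u \<and> u < i \<and> i \<le> inv \<sigma> u \<longrightarrow> u \<le> \<sigma> i)"
    unfolding special_at_def greatest_free_def Ball_def free_col_iff[OF s i] ..
  have inv: "\<sigma> (inv \<sigma> u) = u" "inv \<sigma> (\<sigma> u) = u" for u using permutes_inverses[OF s] by auto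
  have range: "\<sigma> j \<in> {1..n}" "inv \<sigma> j \<in> {1..n}" if "j \<in> {1..n}" for j
    using that permutes_in_image[OF s] permutes_in_image[OF permutes_inv[OF s]] by auto
  show ?thesis
  proof
    assume "special_at greatest_free n \<sigma> i"
    then have sp: "inv \<sigma> i < i" "\<sigma> i < i" "\<And>u. \<lbrakk>1 \<le> u; u < i; i \<le> inv \<sigma> u\<rbrakk> \<Longrightarrow> u \<le> \<sigma> i"
      unfolding special by auto
    have "\<sigma> j \<notin> {\<sigma> i..i}" if j: "j \<in> {i<..n}" for j
    proof
      assume in_int: "\<sigma> j \<in> {\<sigma> i..i}"
      have "\<sigma> j \<noteq> i" using sp(1) inv(2)[of j] j by auto
      then have "\<sigma> j \<le> \<sigma> i" using sp(3)[of "\<sigma> j"] inv(2)[of j] range(1)[of j] j in_int by simp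
      then have "\<sigma> j = \<sigma> i" using in_int by simp
      then have "j = i" using inv(2) by metis
      then show False using j by simp
    qed
    then show "\<sigma> i < i \<and> (\<forall>j\<in>{i<..n}. \<sigma> j \<notin> {\<sigma> i..i})" using sp(2) by blast
  next
    assume a: "\<sigma> i < i \<and> (\<forall>j\<in>{i<..n}. \<sigma> j \<notin> {\<sigma> i..i})"
    have "inv \<sigma> i < i"
    proof (rule ccontr)
      assume "\<not> inv \<sigma> i < i"
      moreover have "inv \<sigma> i \<noteq> i" using a inv(1)[of i] by auto
      ultimately have "inv \<sigma> i \<in> {i<..n}" using range(2)[OF i] by simp
      then have "\<sigma> (inv \<sigma> i) \<notin> {\<sigma> i..i}" using a by blast
      then show False using a inv(1)[of i] by simp
    qed
    moreover have "u \<le> \<sigma> i" if u: "1 \<le> u" "u < i" "i \<le> inv \<sigma> u" for u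
    proof (cases "inv \<sigma> u = i")
      case True
      then show ?thesis using inv(1)[of u] by simp
    next
      case False
      then have "inv \<sigma> u \<in> {i<..n}" using u i range(2)[of u] by simp
      then have "\<sigma> (inv \<sigma> u) \<notin> {\<sigma> i..i}" using a by blast
      then show ?thesis using inv(1)[of u] u by simp
    qed
    ultimately show "special_at greatest_free n \<sigma> i" unfolding special using a by blast
  qed
qed

section \<open>Conjugation by the reversal of \<open>{1..n}\<close>\<close>

definition reversal :: "nat \<Rightarrow> nat \<Rightarrow> nat" where
  "reversal n i = (if i \<in> {1..n} then n + 1 - i else i)"

lemma reversal_reversal [simp]: "reversal n (reversal n i) = i"
  by (auto simp: reversal_def)

lemma reversal_in: "reversal n i \<in> {1..n} \<longleftrightarrow> i \<in> {1..n}"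
  by (auto simp: reversal_def)

lemma reversal_permutes: "reversal n permutes {1..n}"
proof (rule bij_imp_permutes)
  show "bij_betw (reversal n) {1..n} {1..n}"
    by (rule bij_betw_byWitness[where f' = "reversal n"]) (auto simp: reversal_def)
qed (simp only: reversal_def if_False)

lemma reversal_less: "i \<in> {1..n} \<Longrightarrow> j \<in> {1..n} \<Longrightarrow> reversal n i < reversal n j \<longleftrightarrow> j < i"
  by (auto simp: reversal_def)

lemma card_reversal:
  assumes "\<And>i. i \<in> {1..n} \<Longrightarrow> P (reversal n i) \<longleftrightarrow> Q i"
  shows "card {i \<in> {1..n}. P i} = card {i \<in> {1..n}. Q i}"
proof (rule bij_betw_same_card)
  have "Q (reversal n i) \<longleftrightarrow> P i" if "i \<in> {1..n}" for i
    using assms[of "reversal n i"] that reversal_in[of n i] by (simp only: reversal_reversal)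
  then show "bij_betw (reversal n) {i \<in> {1..n}. P i} {i \<in> {1..n}. Q i}"
    using assms reversal_in[of n]
    by (intro bij_betw_byWitness[where f' = "reversal n"]) (auto simp del: atLeastAtMost_iff)
qed

definition rev_conj :: "nat \<Rightarrow> (nat \<Rightarrow> nat) \<Rightarrow> nat \<Rightarrow> nat" where
  "rev_conj n \<sigma> = reversal n \<circ> \<sigma> \<circ> reversal n"

lemma rev_conj_permutes: "\<sigma> permutes {1..n} \<Longrightarrow> rev_conj n \<sigma> permutes {1..n}"
  unfolding rev_conj_def by (intro permutes_compose reversal_permutes)

lemma rev_conj_rev_conj: "rev_conj n (rev_conj n \<sigma>) = \<sigma>"
  by (simp add: rev_conj_def fun_eq_iff)

text \<open>Reversal inverts the order of both positions and values: \<open>\<sigma> i < i\<close>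
  turns into an excedance, later positions turn into earlier ones, and the interval from
  \<open>\<sigma> i\<close> to \<open>i\<close> is traversed the other way.\<close>

lemma rev_conj_stats:
  assumes s: "\<sigma> permutes {1..n}"
  shows "card {i \<in> {1..n}. rev_conj n \<sigma> i < i} = exc n \<sigma>"
    and "fixpts n (rev_conj n \<sigma>) = fixpts n \<sigma>"
    and "card {i \<in> {1..n}. special_at greatest_free n (rev_conj n \<sigma>) i} = pex n \<sigma>"
proof -
  have val: "rev_conj n \<sigma> (reversal n i) = reversal n (\<sigma> i)" for i by (simp add: rev_conj_def)
  have range: "\<sigma> i \<in> {1..n}" if "i \<in> {1..n}" for i using that permutes_in_image[OF s] by blast
  show "card {i \<in> {1..n}. rev_conj n \<sigma> i < i} = exc n \<sigma>"
    unfolding exc_def by (rule card_reversal) (simp only: val reversal_less range)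
  show "fixpts n (rev_conj n \<sigma>) = fixpts n \<sigma>"
    unfolding fixpts_def by (rule card_reversal) (metis val reversal_reversal)
  show "card {i \<in> {1..n}. special_at greatest_free n (rev_conj n \<sigma>) i} = pex n \<sigma>"
    unfolding pex_def
  proof (rule card_reversal)
    fix i assume i: "i \<in> {1..n}"
    have iff: "reversal n (\<sigma> j) \<in> {reversal n (\<sigma> i)..reversal n i} \<longleftrightarrow> \<sigma> j \<in> {i..\<sigma> i}"
      if "j \<in> {1..n}" for j
      using reversal_less[OF range[OF that] range[OF i]] reversal_less[OF i range[OF that]]
      by (auto simp: not_less[symmetric] simp del: atLeastAtMost_iff) (simp_all add: not_less)
    have ball: "(\<forall>j\<in>{reversal n i<..n}. P j) \<longleftrightarrow> (\<forall>j\<in>{1..<i}. P (reversal n j))" for P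
    proof safe
      fix j assume *: "\<forall>j\<in>{reversal n i<..n}. P j" "j \<in> {1..<i}"
      then have "reversal n i < reversal n j" "reversal n j \<in> {1..n}"
        using i by (auto simp: reversal_def)
      then show "P (reversal n j)" using * by simp
    next
      fix j assume *: "\<forall>j\<in>{1..<i}. P (reversal n j)" "j \<in> {reversal n i<..n}"
      then have "reversal n j \<in> {1..<i}" using i by (auto simp: reversal_def)
      then show "P j" using * by fastforce
    qed
    have "special_at greatest_free n (rev_conj n \<sigma>) (reversal n i) \<longleftrightarrow>
        i < \<sigma> i \<and> (\<forall>j\<in>{1..<i}. reversal n (\<sigma> j) \<notin> {reversal n (\<sigma> i)..reversal n i})"
      using special_at_greatest_free[OF rev_conj_permutes[OF s], of "reversal n i"] i
      by (simp only: reversal_in val ball reversal_less range)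
    also have "\<dots> \<longleftrightarrow> i < \<sigma> i \<and> (\<forall>j\<in>{1..<i}. \<sigma> j \<notin> {i..\<sigma> i})"
    proof -
      have "reversal n (\<sigma> j) \<in> {reversal n (\<sigma> i)..reversal n i} \<longleftrightarrow> \<sigma> j \<in> {i..\<sigma> i}"
        if "j \<in> {1..<i}" for j using iff[of j] that i by simp
      then show ?thesis by blast
    qed
    finally show "special_at greatest_free n (rev_conj n \<sigma>) (reversal n i) \<longleftrightarrow>
      i < \<sigma> i \<and> (\<forall>j\<in>{1..<i}. \<sigma> j \<notin> {i..\<sigma> i})" .
  qed
qed

lemma bij_betw_rev_conj: "bij_betw (rev_conj n) {\<sigma>. \<sigma> permutes {1..n}} {\<sigma>. \<sigma> permutes {1..n}}"
  by (rule bij_betw_byWitness[where f' = "rev_conj n"])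
    (use rev_conj_permutes rev_conj_rev_conj in blast)+

lemma B_eq_sum_pex:
  fixes t lam w :: "'a::field_char_0"
  shows "B n t lam w = (\<Sum>\<sigma> | \<sigma> permutes {1..n}. t ^ exc n \<sigma> * lam ^ pex n \<sigma> * w ^ fixpts n \<sigma>)"
proof -
  define h where "h \<sigma> = t ^ card {i \<in> {1..n}. \<sigma> i < i}
    * lam ^ card {i \<in> {1..n}. special_at greatest_free n \<sigma> i} * w ^ fixpts n \<sigma>" for \<sigma>
  \<comment> \<open>Here \<open>te = 1\<close> and \<open>td = t\<close>, because the reversal will
    exchange the two sides of the diagonal.\<close>
  have "B n t lam w = (\<Sum>\<sigma> | \<sigma> permutes {1..n}.
    1 ^ card {i \<in> {1..n}. i < \<sigma> i} * t ^ card {i \<in> {1..n}. \<sigma> i < i}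
      * lam ^ card {i \<in> {1..n}. special_at greatest_free n \<sigma> i} * w ^ fixpts n \<sigma>)"
    by (rule B_eq_sum_special[OF rook_weights_greatest_free]) simp_all
  also have "\<dots> = (\<Sum>\<sigma> | \<sigma> permutes {1..n}. h \<sigma>)"
    by (simp only: h_def power_one mult_1_left)
  also have "\<dots> = (\<Sum>\<sigma> | \<sigma> permutes {1..n}. h (rev_conj n \<sigma>))"
    by (rule sum.reindex_bij_betw[OF bij_betw_rev_conj, symmetric])
  also have "\<dots> = (\<Sum>\<sigma> | \<sigma> permutes {1..n}. t ^ exc n \<sigma> * lam ^ pex n \<sigma> * w ^ fixpts n \<sigma>)"
    by (rule sum.cong[OF refl]) (simp only: h_def mem_Collect_eq rev_conj_stats)
  finally show ?thesis .
qed

text \<open>The path from \<open>\<sigma> i\<close> to \<open>inv \<sigma> i\<close> is the cycle of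
  \<open>i\<close> with \<open>i\<close> removed. It stays in the square of side
  \<open>i - 1\<close> exactly when \<open>i\<close> is the maximum of its cycle.\<close>

lemma special_at_same_path:
  assumes s: "\<sigma> permutes {1..n}" and i: "i \<in> {1..n}"
  shows "special_at same_path n \<sigma> i \<longleftrightarrow> (\<forall>x\<in>orbit \<sigma> i. x \<le> i) \<and> \<sigma> i \<noteq> i"
proof -
  define R where "R = corner (i - 1) (graph n \<sigma>)"
  have R: "(x, y) \<in> R \<longleftrightarrow> y = \<sigma> x \<and> x < i \<and> y < i \<and> 1 \<le> x \<and> 1 \<le> y" for x y
    using i by (auto simp: R_def in_graph)
  have inv: "\<sigma> (inv \<sigma> u) = u" "inv \<sigma> (\<sigma> u) = u" for u using permutes_inverses[OF s] by auto
  show ?thesis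
  proof
    assume "special_at same_path n \<sigma> i"
    then have sp: "\<sigma> i < i" "inv \<sigma> i < i" "(\<sigma> i, inv \<sigma> i) \<in> R\<^sup>*"
      by (auto simp: special_at_def same_path_def R_def)
    \<comment> \<open>The induction along the orbit carries the remaining path to
      \<open>inv \<sigma> i\<close>, whose first cell supplies the next element.\<close>
    have "x = i \<or> x < i \<and> (x, inv \<sigma> i) \<in> R\<^sup>*" if "x \<in> orbit \<sigma> i" for x
      using that
    proof (induction x rule: orbit.induct)
      case base
      then show ?case using sp by simp
    next
      case (step x)
      show ?case
      proof (cases "x = i \<or> x = inv \<sigma> i")
        case True
        then show ?thesis using sp inv by auto
      next
        case False
        then have "(x, inv \<sigma> i) \<in> R\<^sup>*" using step.IH by blast
        then obtain z where "(x, z) \<in> R" "(z, inv \<sigma> i) \<in> R\<^sup>*"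
          using False by (auto elim: converse_rtranclE)
        then show ?thesis by (simp add: R)
      qed
    qed
    then show "(\<forall>x\<in>orbit \<sigma> i. x \<le> i) \<and> \<sigma> i \<noteq> i" using sp(1) by fastforce
  next
    assume a: "(\<forall>x\<in>orbit \<sigma> i. x \<le> i) \<and> \<sigma> i \<noteq> i"
    have orb: "(\<sigma> ^^ k) i \<in> orbit \<sigma> i" if "0 < k" for k
      unfolding orbit_altdef using that by blast
    have "permutation \<sigma>" unfolding permutation_permutes using s finite_atLeastAtMost by blast
    then have "i \<in> orbit \<sigma> i" by (rule permutation_self_in_orbit)
    then obtain m where "i = (\<sigma> ^^ m) i" "0 < m" unfolding orbit_altdef by blast
    then have ex: "\<exists>k. 0 < k \<and> (\<sigma> ^^ k) i = i" by metis
    \<comment> \<open>\<open>L\<close> is the length of the cycle of \<open>i\<close>; its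
      minimality keeps the intermediate iterates different from \<open>i\<close>.\<close>
    define L where "L = (LEAST k. 0 < k \<and> (\<sigma> ^^ k) i = i)"
    have L: "0 < L" "(\<sigma> ^^ L) i = i"
      using LeastI_ex[OF ex] unfolding L_def by auto
    have less: "(\<sigma> ^^ k) i < i" if "0 < k" "k < L" for k
    proof -
      have "(\<sigma> ^^ k) i \<noteq> i" using not_less_Least[of k "\<lambda>k. 0 < k \<and> (\<sigma> ^^ k) i = i"] that
        unfolding L_def by blast
      moreover have "(\<sigma> ^^ k) i \<le> i" using a orb[OF that(1)] by blast
      ultimately show ?thesis by simp
    qed
    have pos: "1 \<le> (\<sigma> ^^ k) i" for k
      using permutes_in_image[OF permutes_funpow[OF s], of k i] i by auto
    have path: "(\<sigma> i, (\<sigma> ^^ Suc k) i) \<in> R\<^sup>*" if "Suc k < L" for k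
      using that
    proof (induction k)
      case (Suc k)
      have "((\<sigma> ^^ Suc k) i, (\<sigma> ^^ Suc (Suc k)) i) \<in> R"
        using less[of "Suc k"] less[of "Suc (Suc k)"] pos[of "Suc k"] pos[of "Suc (Suc k)"] Suc.prems
        unfolding R by simp
      then show ?case using Suc by (meson Suc_lessD rtrancl.rtrancl_into_rtrancl)
    qed simp
    have "L \<noteq> 1" using L(2) a by auto
    \<comment> \<open>A cycle that is not a fixed point has length at least 2, so
      \<open>inv \<sigma> i\<close> is the iterate with exponent
      \<open>L - 1 = Suc k\<close>.\<close>
    then obtain k where k: "L = Suc (Suc k)" using L(1) by (cases L; cases "L - 1") auto
    have "\<sigma> ((\<sigma> ^^ Suc k) i) = i" using L(2) k by simp
    then have q: "inv \<sigma> i = (\<sigma> ^^ Suc k) i" using inv(2) by metis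
    show "special_at same_path n \<sigma> i"
      unfolding special_at_def same_path_def R_def[symmetric] q
      using path[of k] less[of 1] less[of "Suc k"] k by simp
  qed
qed

text \<open>Each cycle is represented by its maximum, collected in \<open>M\<close>. Fixed points
  are maxima of their own cycles, so subtracting their number amounts to removing them from
  \<open>M\<close>.\<close>

lemma pcyc_eq:
  assumes s: "\<sigma> permutes {1..n}"
  shows "pcyc n \<sigma> = card {i \<in> {1..n}. special_at same_path n \<sigma> i}"
proof -
  define M where "M = {i \<in> {1..n}. \<forall>x\<in>orbit \<sigma> i. x \<le> i}"
  have perm: "permutation \<sigma>" unfolding permutation_permutes using s finite_atLeastAtMost by blast
  have self: "x \<in> orbit \<sigma> x" for x by (rule permutation_self_in_orbit[OF perm])
  have orb_eq: "orbit \<sigma> x = orbit \<sigma> y" if "x \<in> orbit \<sigma> y" for x y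
    by (rule orbit_cyclic_eq3[OF cyclic_on_orbit'[OF perm] that])
  have sub: "orbit \<sigma> x \<subseteq> {1..n}" if "x \<in> {1..n}" for x
    by (rule permutes_orbit_subset[OF s that])
  have "inj_on (orbit \<sigma>) M"
  proof (rule inj_onI)
    fix x y assume "x \<in> M" "y \<in> M" "orbit \<sigma> x = orbit \<sigma> y"
    then show "x = y" using self[of x] self[of y] by (auto simp: M_def intro: le_antisym)
  qed
  moreover have "orbit \<sigma> ` M = orbit \<sigma> ` {1..n}"
  proof (rule equalityI)
    show "orbit \<sigma> ` {1..n} \<subseteq> orbit \<sigma> ` M"
    proof (rule image_subsetI)
      fix x assume x: "x \<in> {1..n}"
      define y where "y = Max (orbit \<sigma> x)"
      have fin: "finite (orbit \<sigma> x)" using sub[OF x] finite_subset by blast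
      then have y: "y \<in> orbit \<sigma> x" unfolding y_def using self by (intro Max_in) auto
      then have "y \<in> M" using sub[OF x] orb_eq[OF y] fin by (auto simp: M_def y_def)
      then show "orbit \<sigma> x \<in> orbit \<sigma> ` M" using orb_eq[OF y] by blast
    qed
  qed (auto simp: M_def)
  ultimately have "cyc n \<sigma> = card M" unfolding cyc_def by (metis card_image)
  moreover have "{i \<in> {1..n}. \<sigma> i = i} \<subseteq> M"
  proof
    fix i assume i: "i \<in> {i \<in> {1..n}. \<sigma> i = i}"
    then have "orbit \<sigma> i = {i}" by (simp add: orbit_eq_singleton_iff)
    then show "i \<in> M" using i by (simp add: M_def)
  qed
  moreover have "{i \<in> {1..n}. special_at same_path n \<sigma> i} = M - {i \<in> {1..n}. \<sigma> i = i}"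
    using special_at_same_path[OF s] by (auto simp: M_def)
  ultimately show ?thesis
    unfolding pcyc_def fixpts_def by (simp add: card_Diff_subset)
qed

lemma B_eq_sum_pcyc:
  fixes t lam w :: "'a::field_char_0"
  shows "B n t lam w = (\<Sum>\<sigma> | \<sigma> permutes {1..n}. t ^ exc n \<sigma> * lam ^ pcyc n \<sigma> * w ^ fixpts n \<sigma>)"
proof -
  have "B n t lam w = (\<Sum>\<sigma> | \<sigma> permutes {1..n}.
    t ^ card {i \<in> {1..n}. i < \<sigma> i} * 1 ^ card {i \<in> {1..n}. \<sigma> i < i}
      * lam ^ card {i \<in> {1..n}. special_at same_path n \<sigma> i} * w ^ fixpts n \<sigma>)"
    by (rule B_eq_sum_special[OF rook_weights_same_path]) simp_all
  also have "\<dots> = (\<Sum>\<sigma> | \<sigma> permutes {1..n}. t ^ exc n \<sigma> * lam ^ pcyc n \<sigma> * w ^ fixpts n \<sigma>)"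
    by (rule sum.cong[OF refl]) (simp only: mem_Collect_eq pcyc_eq exc_def power_one mult_1_right)
  finally show ?thesis .
qed

theorem theorem1p5:
  fixes t lam w :: "'a::field_char_0"
  shows
    "(\<forall>n.
        B n t lam w
          = (\<Sum>\<sigma> | \<sigma> permutes {1..n}. t ^ exc n \<sigma> * lam ^ pcyc n \<sigma> * w ^ fixpts n \<sigma>)
      \<and> B n t lam w
          = (\<Sum>\<sigma> | \<sigma> permutes {1..n}. t ^ exc n \<sigma> * lam ^ ear n \<sigma> * w ^ fixpts n \<sigma>)
      \<and> B n t lam w
          = (\<Sum>\<sigma> | \<sigma> permutes {1..n}. t ^ exc n \<sigma> * lam ^ pex n \<sigma> * w ^ fixpts n \<sigma>)
      \<and> B n t lam w
          = (\<Sum>\<sigma> | \<sigma> permutes {1..n}. t ^ des n \<sigma> * lam ^ des2 n \<sigma> * w ^ fmax n \<sigma>))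
     \<and> (t \<noteq> 1 \<longrightarrow>
          Abs_fps (\<lambda>n. B n t lam w / fact n)
            = fps_exp w
              * fps_pow (fps_const (1 - t) / (fps_exp t - fps_const t * fps_exp 1)) lam)"
proof (intro conjI allI impI)
  fix n
  show "B n t lam w
      = (\<Sum>\<sigma> | \<sigma> permutes {1..n}. t ^ exc n \<sigma> * lam ^ pcyc n \<sigma> * w ^ fixpts n \<sigma>)"
    by (rule B_eq_sum_pcyc)
  show "B n t lam w
      = (\<Sum>\<sigma> | \<sigma> permutes {1..n}. t ^ exc n \<sigma> * lam ^ ear n \<sigma> * w ^ fixpts n \<sigma>)"
    by (rule B_eq_sum_ear)
  show "B n t lam w
      = (\<Sum>\<sigma> | \<sigma> permutes {1..n}. t ^ exc n \<sigma> * lam ^ pex n \<sigma> * w ^ fixpts n \<sigma>)"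
    by (rule B_eq_sum_pex)
  show "B n t lam w
      = (\<Sum>\<sigma> | \<sigma> permutes {1..n}. t ^ des n \<sigma> * lam ^ des2 n \<sigma> * w ^ fmax n \<sigma>)"
    by (rule B_eq_sum_des)
next
  assume "t \<noteq> 1"
  from B_egf[OF EGF_ode_explicit[OF this]]
  show "Abs_fps (\<lambda>n. B n t lam w / fact n)
      = fps_exp w * fps_pow (fps_const (1 - t) / (fps_exp t - fps_const t * fps_exp 1)) lam"
    by (intro fps_ext) simp
qed

end
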